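(* Let $(\mathcal{E}^k)_{k\in\mathbb{N}}$ be a sequence of Dirichlet forms with domains $\mathrm{dom}(\mathcal{E}^k)\subset L^2=L^2(X,m)$ and associated semigroups $(T^{(k)}_t)_{t>0}$. Assume that $\mathcal{E}^k$ converges in the sense of Mosco to a Dirichlet form $\mathcal{E}^\infty$ in $L^2$, with semigroup $(T_t^\infty)_{t>0}$. Let $Y$ be a set which is $T_t^{(k)}$-invariant for each $k\in\mathbb{N}$. Then (a) the set $Y$ is $T_t^\infty$-invariant as well; (b) $(\mathcal{E}^k)^Y$ converges to $(\mathcal{E}^\infty)^Y$ in the sense of Mosco (as Dirichlet forms in $L^2(Y,m|_Y)$).
   Context: $X$ is a Hausdorff topological space and $m$ is a positive $\sigma$-finite Radon measure on a $\sigma$-algebra $\mathcal{A}$ of subsets of $X$, with full support $X$. All equalities and inequalities of functions are understood $m$-a.e. A Dirichlet form $\mathcal{E}$ with domain $\mathcal{D}\subset L^2$ is a (symmetric, nonnegative) densely defined closed quadratic form such that $u\in\mathcal{D}$ implies $u_{0,1}:=\min(\max(u,0),1)\in\mathcal{D}$ and $\mathcal{E}[u_{0,1}]\le\mathcal{E}[u]$. Its semigroup is $T_t=e^{-tL}$, $t>0$, with $L$ the nonnegative selfadjoint operator of $\mathcal{E}$. A measurable set $Y\subset X$ is $T_t$-invariant if $T_t(1_Yu)=1_YT_tu$ for all $u\in L^2$ and some (equivalently every) $t>0$. For invariant $Y$, $1_Yu\in\mathcal{D}$ for all $u\in\mathcal{D}$, and $\mathcal{E}^Y$ denotes the Dirichlet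 form in $L^2(Y,m|_Y)$ with domain $\{u|_Y:u\in\mathcal{D}\}$ and $\mathcal{E}^Y[u|_Y]=\mathcal{E}[1_Yu]$. Mosco convergence: quadratic forms in a Hilbert space $\mathcal{H}$ are extended by $+\infty$ outside their domains; a sequence $(a_n)$ of nonnegative quadratic forms Mosco-converges to $a_\infty$ in $\mathcal{H}$ if (M1) $u_n\to u$ weakly in $\mathcal{H}$ implies $\liminf_na_n[u_n]\ge a_\infty[u]$, and (M2) for every $u\in\mathcal{H}$ there is a sequence $(u_n)$ in $\mathcal{H}$ with $u_n\to u$ in $\mathcal{H}$ and $\limsup_na_n[u_n]\le a_\infty[u]$. *)

theory Defs
  imports "HOL-Analysis.Analysis"
begin

text \<open>
  A Radon measure on a \<sigma>-algebra containing the Borel sets of \<open>X\<close>: locally finite, and inner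
  regular with respect to compact sets. The \<sigma>-algebra may be larger than the Borel one
  (e.g. its completion).
\<close>

definition radon_measure :: "'a topology \<Rightarrow> 'a measure \<Rightarrow> bool" where
  "radon_measure X M \<longleftrightarrow>
     space M = topspace X \<and>
     (\<forall>U. openin X U \<longrightarrow> U \<in> sets M) \<and>
     (\<forall>x\<in>topspace X. \<exists>U. openin X U \<and> x \<in> U \<and> emeasure M U < \<infinity>) \<and>
     (\<forall>A\<in>sets M. emeasure M A = (SUP K\<in>{K. compactin X K \<and> K \<subseteq> A}. emeasure M K))"

definition full_support :: "'a topology \<Rightarrow> 'a measure \<Rightarrow> bool" where
  "full_support X M \<longleftrightarrow> (\<forall>U. openin X U \<and> U \<noteq> {} \<longrightarrow> emeasure M U > 0)"

text \<open>
  The real Hilbert space \<open>L\<^sup>2(M)\<close> is represented by square-integrable functions; equality of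
  elements is equality almost everywhere.
\<close>

definition L2 :: "'a measure \<Rightarrow> ('a \<Rightarrow> real) set" where
  "L2 M = {u \<in> borel_measurable M. integrable M (\<lambda>x. (u x)\<^sup>2)}"

definition l2_inner :: "'a measure \<Rightarrow> ('a \<Rightarrow> real) \<Rightarrow> ('a \<Rightarrow> real) \<Rightarrow> real" where
  "l2_inner M u v = (\<integral>x. u x * v x \<partial>M)"

definition l2_norm :: "'a measure \<Rightarrow> ('a \<Rightarrow> real) \<Rightarrow> real" where
  "l2_norm M u = sqrt (l2_inner M u u)"

definition l2_tendsto ::
    "'a measure \<Rightarrow> ('i \<Rightarrow> 'a \<Rightarrow> real) \<Rightarrow> ('a \<Rightarrow> real) \<Rightarrow> 'i filter \<Rightarrow> bool" where
  "l2_tendsto M U u F \<longleftrightarrow> ((\<lambda>i. l2_norm M (\<lambda>x. U i x - u x)) \<longlongrightarrow> 0) F"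

definition l2_weak_tendsto ::
    "'a measure \<Rightarrow> ('i \<Rightarrow> 'a \<Rightarrow> real) \<Rightarrow> ('a \<Rightarrow> real) \<Rightarrow> 'i filter \<Rightarrow> bool" where
  "l2_weak_tendsto M U u F \<longleftrightarrow>
     (\<forall>v\<in>L2 M. ((\<lambda>i. l2_inner M (U i) v) \<longlongrightarrow> l2_inner M u v) F)"

text \<open>
  A quadratic form is given by its domain and its polarization; values of \<open>form_bil\<close> outside the
  domain are irrelevant.
\<close>

record 'a qform =
  form_dom :: "('a \<Rightarrow> real) set"
  form_bil :: "('a \<Rightarrow> real) \<Rightarrow> ('a \<Rightarrow> real) \<Rightarrow> real"

definition form_val :: "'a qform \<Rightarrow> ('a \<Rightarrow> real) \<Rightarrow> real" where
  "form_val E u = form_bil E u u"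

definition form_ext :: "'a qform \<Rightarrow> ('a \<Rightarrow> real) \<Rightarrow> ereal" where
  "form_ext E u = (if u \<in> form_dom E then ereal (form_val E u) else \<infinity>)"

text \<open>The second conjunct says that domain and form are well defined on a.e.-classes.\<close>

definition nonneg_quadratic_form :: "'a measure \<Rightarrow> 'a qform \<Rightarrow> bool" where
  "nonneg_quadratic_form M E \<longleftrightarrow>
     form_dom E \<subseteq> L2 M \<and>
     (\<forall>u\<in>form_dom E. \<forall>v\<in>L2 M. (AE x in M. u x = v x) \<longrightarrow>
        v \<in> form_dom E \<and> (\<forall>w\<in>form_dom E. form_bil E v w = form_bil E u w)) \<and>
     (\<lambda>x. 0) \<in> form_dom E \<and>
     (\<forall>u\<in>form_dom E. \<forall>v\<in>form_dom E. \<forall>a b. (\<lambda>x. a * u x + b * v x) \<in> form_dom E) \<and>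
     (\<forall>u\<in>form_dom E. \<forall>v\<in>form_dom E. \<forall>w\<in>form_dom E. \<forall>a b.
        form_bil E (\<lambda>x. a * u x + b * v x) w = a * form_bil E u w + b * form_bil E v w) \<and>
     (\<forall>u\<in>form_dom E. \<forall>v\<in>form_dom E. form_bil E u v = form_bil E v u) \<and>
     (\<forall>u\<in>form_dom E. form_val E u \<ge> 0)"

definition densely_defined :: "'a measure \<Rightarrow> 'a qform \<Rightarrow> bool" where
  "densely_defined M E \<longleftrightarrow>
     (\<forall>u\<in>L2 M. \<forall>e>0. \<exists>v\<in>form_dom E. l2_norm M (\<lambda>x. u x - v x) < e)"

definition closed_form :: "'a measure \<Rightarrow> 'a qform \<Rightarrow> bool" where
  "closed_form M E \<longleftrightarrow>
     (\<forall>U u. (\<forall>n. U n \<in> form_dom E) \<and> u \<in> L2 M \<and> l2_tendsto M U u sequentially \<and>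
        (\<forall>e>0. \<exists>N. \<forall>m\<ge>N. \<forall>n\<ge>N. form_val E (\<lambda>x. U m x - U n x) < e) \<longrightarrow>
        u \<in> form_dom E \<and> (\<lambda>n. form_val E (\<lambda>x. U n x - u x)) \<longlonglongrightarrow> (0::real))"

definition dirichlet_form :: "'a measure \<Rightarrow> 'a qform \<Rightarrow> bool" where
  "dirichlet_form M E \<longleftrightarrow>
     nonneg_quadratic_form M E \<and> densely_defined M E \<and> closed_form M E \<and>
     (\<forall>u\<in>form_dom E. (\<lambda>x. min (max (u x) 0) 1) \<in> form_dom E \<and>
        form_val E (\<lambda>x. min (max (u x) 0) 1) \<le> form_val E u)"

text \<open>
  Operators on \<open>L\<^sup>2(M)\<close> are given by their graphs. \<open>form_operator M E u f\<close> says that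
  \<open>u\<close> is in the domain of the selfadjoint operator \<open>L\<close> of the form and \<open>L u = f\<close>.
\<close>

definition form_operator ::
    "'a measure \<Rightarrow> 'a qform \<Rightarrow> ('a \<Rightarrow> real) \<Rightarrow> ('a \<Rightarrow> real) \<Rightarrow> bool" where
  "form_operator M E u f \<longleftrightarrow>
     u \<in> form_dom E \<and> f \<in> L2 M \<and> (\<forall>v\<in>form_dom E. form_bil E u v = l2_inner M f v)"

definition contraction_semigroup ::
    "'a measure \<Rightarrow> (real \<Rightarrow> ('a \<Rightarrow> real) \<Rightarrow> 'a \<Rightarrow> real) \<Rightarrow> bool" where
  "contraction_semigroup M T \<longleftrightarrow>
     (\<forall>t>0. \<forall>u\<in>L2 M. T t u \<in> L2 M) \<and>
     (\<forall>t>0. \<forall>u\<in>L2 M. \<forall>v\<in>L2 M. \<forall>a b.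
        AE x in M. T t (\<lambda>y. a * u y + b * v y) x = a * T t u x + b * T t v x) \<and>
     (\<forall>t>0. \<forall>u\<in>L2 M. \<forall>v\<in>L2 M. l2_inner M (T t u) v = l2_inner M u (T t v)) \<and>
     (\<forall>t>0. \<forall>u\<in>L2 M. l2_norm M (T t u) \<le> l2_norm M u) \<and>
     (\<forall>s>0. \<forall>t>0. \<forall>u\<in>L2 M. AE x in M. T (s + t) u x = T s (T t u) x) \<and>
     (\<forall>u\<in>L2 M. l2_tendsto M (\<lambda>t. T t u) u (at_right 0))"

definition semigroup_generator ::
    "'a measure \<Rightarrow> (real \<Rightarrow> ('a \<Rightarrow> real) \<Rightarrow> 'a \<Rightarrow> real) \<Rightarrow> ('a \<Rightarrow> real) \<Rightarrow> ('a \<Rightarrow> real) \<Rightarrow> bool"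
  where
  "semigroup_generator M T u f \<longleftrightarrow>
     u \<in> L2 M \<and> f \<in> L2 M \<and> l2_tendsto M (\<lambda>t x. (T t u x - u x) / t) f (at_right 0)"

text \<open>
  \<open>T t = exp (- t L)\<close>: the family \<open>T\<close> is the strongly continuous semigroup of symmetric
  contractions with generator \<open>- L\<close>, where \<open>L\<close> is the operator of the form. The generator
  determines \<open>T\<close> uniquely (up to a.e. equality).
\<close>

definition form_semigroup ::
    "'a measure \<Rightarrow> 'a qform \<Rightarrow> (real \<Rightarrow> ('a \<Rightarrow> real) \<Rightarrow> 'a \<Rightarrow> real) \<Rightarrow> bool" where
  "form_semigroup M E T \<longleftrightarrow>
     contraction_semigroup M T \<and>
     (\<forall>u f. semigroup_generator M T u f \<longleftrightarrow> form_operator M E u (\<lambda>x. - f x))"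

text \<open>Here \<open>S\<close> is a single operator of the semigroup.\<close>

definition invariant_set ::
    "'a measure \<Rightarrow> (('a \<Rightarrow> real) \<Rightarrow> 'a \<Rightarrow> real) \<Rightarrow> 'a set \<Rightarrow> bool" where
  "invariant_set M S Y \<longleftrightarrow>
     Y \<in> sets M \<and>
     (\<forall>u\<in>L2 M. AE x in M. S (\<lambda>y. indicator Y y * u y) x = indicator Y x * S u x)"

text \<open>
  The form \<open>E\<^sup>Y\<close> on \<open>L\<^sup>2(Y, m|Y)\<close>. Elements of the latter are represented by total functions
  whose values outside \<open>Y\<close> are irrelevant, so \<open>f = u|Y\<close> means that \<open>f\<close> and \<open>u\<close> agree on \<open>Y\<close>;
  then \<open>indicator Y * f = indicator Y * u\<close>.
\<close>

definition form_restrict :: "'a set \<Rightarrow> 'a qform \<Rightarrow> 'a qform" where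
  "form_restrict Y E =
     \<lparr> form_dom = {f. \<exists>u\<in>form_dom E. \<forall>x\<in>Y. f x = u x},
       form_bil = (\<lambda>f g. form_bil E (\<lambda>x. indicator Y x * f x) (\<lambda>x. indicator Y x * g x)) \<rparr>"

definition mosco_converges :: "'a measure \<Rightarrow> (nat \<Rightarrow> 'a qform) \<Rightarrow> 'a qform \<Rightarrow> bool" where
  "mosco_converges M E Einf \<longleftrightarrow>
     (\<forall>U u. (\<forall>n. U n \<in> L2 M) \<and> u \<in> L2 M \<and> l2_weak_tendsto M U u sequentially \<longrightarrow>
        form_ext Einf u \<le> liminf (\<lambda>n. form_ext (E n) (U n))) \<and>
     (\<forall>u\<in>L2 M. \<exists>U. (\<forall>n. U n \<in> L2 M) \<and> l2_tendsto M U u sequentially \<and>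
        limsup (\<lambda>n. form_ext (E n) (U n)) \<le> form_ext Einf u)"

end

theory Submission
  imports Defs
begin

text \<open>
  Write \<open>P\<close> for multiplication by the indicator of \<open>Y\<close>, an orthogonal projection of \<open>L\<^sup>2\<close>.
  Invariance of \<open>Y\<close> has three equivalent descriptions: \<open>P\<close> commutes with the semigroup; \<open>P\<close>
  commutes with the operator \<open>L\<close>; and \<open>P\<close> maps the domain of the form into itself and splits the
  form orthogonally, so that \<open>E[u] = E[P u] + E[u - P u]\<close>. The third description involves only
  values of the form, and it is the one that survives a Mosco limit.

  \<^emph>\<open>The limit.\<close> Let \<open>U\<^sub>n\<close> be a recovery sequence for \<open>u\<close>. Then \<open>P U\<^sub>n\<close> and \<open>U\<^sub>n - P U\<^sub>n\<close>
  converge to \<open>P u\<close> and \<open>u - P u\<close>, so two applications of the lower bound (M1) and the splitting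
  of the approximating forms give \<open>E\<^sub>\<infinity>[P u] + E\<^sub>\<infinity>[u - P u] \<le> E\<^sub>\<infinity>[u]\<close>. This says that
  \<open>E\<^sub>\<infinity>(P u, u - P u) \<ge> 0\<close>; applied to \<open>P u + s (v - P v)\<close> with \<open>s = 1\<close> and \<open>s = - 1\<close> it
  becomes \<open>E\<^sub>\<infinity>(P u, v - P v) = 0\<close>, the splitting for the limit form
  (\<open>form_invariant_mosco_limit\<close>). Once all forms split, part (b) is extension by zero for (M1) and
  multiplication of a recovery sequence by the indicator for (M2) (\<open>mosco_converges_restrict\<close>).

  \<^emph>\<open>From the semigroup to the form.\<close> Invariance is given for a single time only. It passes from
  \<open>2 s\<close> to \<open>s\<close> because a nonnegative operator commutes with everything that commutes with its square
  (\<open>invariant_set_half\<close>); then dyadic multiples and strong continuity reach every time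
  (\<open>invariant_set_all_times\<close>). Differentiating at \<open>0\<close>, \<open>P\<close> commutes with \<open>L\<close>. Hence
  \<open>E(P u, v - P v) = \<langle>P L u, v - P v\<rangle> = 0\<close> for \<open>u\<close> in the domain of \<open>L\<close>, and this extends to
  the domain of the form because the domain of \<open>L\<close> is a form core. The core property
  (\<open>form_operator_core\<close>) is proved by minimizing \<open>E[w] + \<alpha> \<parallel>w - u\<parallel>\<^sup>2\<close> and letting \<open>\<alpha>\<close> grow; the
  minimizer exists because \<open>L\<^sup>2\<close> is complete and the form is closed.

  \<^emph>\<open>From the form to the semigroup.\<close> The splitting gives back that \<open>P\<close> commutes with \<open>L\<close>. For \<open>u\<close>
  in the domain of \<open>L\<close> the norm of the commutator \<open>[P, T\<^sub>s] u\<close> is continuous from the left in \<open>s\<close>,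
  starts at \<open>0\<close> and grows by at most \<open>o(h)\<close> between \<open>s\<close> and \<open>s + h\<close>, hence vanishes
  (\<open>operator_invariant_imp_commutator_zero\<close>); density of the domain of \<open>L\<close> does the rest.
\<close>

section \<open>Nonnegative quadratic forms\<close>

context
  fixes M :: "'a measure" and E :: "'a qform"
  assumes nqf: "nonneg_quadratic_form M E"
begin

lemma form_dom_L2: "u \<in> form_dom E \<Longrightarrow> u \<in> L2 M"
  using nqf by (auto simp: nonneg_quadratic_form_def)

lemma form_dom_zero: "(\<lambda>x. 0) \<in> form_dom E"
  using nqf by (auto simp: nonneg_quadratic_form_def)

lemma form_dom_lincomb:
  "u \<in> form_dom E \<Longrightarrow> v \<in> form_dom E \<Longrightarrow> (\<lambda>x. a * u x + b * v x) \<in> form_dom E"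
  using nqf by (auto simp: nonneg_quadratic_form_def)

lemma form_bil_lincomb:
  "u \<in> form_dom E \<Longrightarrow> v \<in> form_dom E \<Longrightarrow> w \<in> form_dom E \<Longrightarrow>
    form_bil E (\<lambda>x. a * u x + b * v x) w = a * form_bil E u w + b * form_bil E v w"
  using nqf unfolding nonneg_quadratic_form_def by blast

lemma form_bil_commute:
  "u \<in> form_dom E \<Longrightarrow> v \<in> form_dom E \<Longrightarrow> form_bil E u v = form_bil E v u"
  using nqf by (auto simp: nonneg_quadratic_form_def)

lemma form_val_nonneg: "u \<in> form_dom E \<Longrightarrow> 0 \<le> form_val E u"
  using nqf by (auto simp: nonneg_quadratic_form_def)

lemma form_dom_diff: "u \<in> form_dom E \<Longrightarrow> v \<in> form_dom E \<Longrightarrow> (\<lambda>x. u x - v x) \<in> form_dom E"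
  using form_dom_lincomb[of u v 1 "-1"] by simp

lemma form_dom_add: "u \<in> form_dom E \<Longrightarrow> v \<in> form_dom E \<Longrightarrow> (\<lambda>x. u x + v x) \<in> form_dom E"
  using form_dom_lincomb[of u v 1 1] by simp

lemma form_dom_scale: "u \<in> form_dom E \<Longrightarrow> (\<lambda>x. a * u x) \<in> form_dom E"
  using form_dom_lincomb[of u u a 0] by simp

lemma form_bil_diff_left:
  "u \<in> form_dom E \<Longrightarrow> v \<in> form_dom E \<Longrightarrow> w \<in> form_dom E \<Longrightarrow>
    form_bil E (\<lambda>x. u x - v x) w = form_bil E u w - form_bil E v w"
  using form_bil_lincomb[of u v w 1 "-1"] by simp

lemma form_bil_add_left:
  "u \<in> form_dom E \<Longrightarrow> v \<in> form_dom E \<Longrightarrow> w \<in> form_dom E \<Longrightarrow>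
    form_bil E (\<lambda>x. u x + v x) w = form_bil E u w + form_bil E v w"
  using form_bil_lincomb[of u v w 1 1] by simp

lemma form_bil_scale_left:
  "u \<in> form_dom E \<Longrightarrow> w \<in> form_dom E \<Longrightarrow> form_bil E (\<lambda>x. a * u x) w = a * form_bil E u w"
  using form_bil_lincomb[of u u w a 0] by simp

lemma form_bil_diff_right:
  "u \<in> form_dom E \<Longrightarrow> v \<in> form_dom E \<Longrightarrow> w \<in> form_dom E \<Longrightarrow>
    form_bil E w (\<lambda>x. u x - v x) = form_bil E w u - form_bil E w v"
  by (simp add: form_bil_commute[of w] form_dom_diff form_bil_diff_left)

lemma form_bil_add_right:
  "u \<in> form_dom E \<Longrightarrow> v \<in> form_dom E \<Longrightarrow> w \<in> form_dom E \<Longrightarrow>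
    form_bil E w (\<lambda>x. u x + v x) = form_bil E w u + form_bil E w v"
  by (simp add: form_bil_commute[of w] form_dom_add form_bil_add_left)

lemma form_bil_scale_right:
  "u \<in> form_dom E \<Longrightarrow> w \<in> form_dom E \<Longrightarrow> form_bil E w (\<lambda>x. a * u x) = a * form_bil E w u"
  by (simp add: form_bil_commute[of w] form_dom_scale form_bil_scale_left)

lemmas form_dom_closed = form_dom_diff form_dom_add form_dom_scale
lemmas form_bil_bilinear =
  form_bil_diff_left form_bil_add_left form_bil_scale_left
  form_bil_diff_right form_bil_add_right form_bil_scale_right

lemma form_val_add:
  assumes "u \<in> form_dom E" "v \<in> form_dom E"
  shows "form_val E (\<lambda>x. u x + v x) = form_val E u + 2 * form_bil E u v + form_val E v"
  using assms by (simp add: form_val_def form_bil_bilinear form_dom_closed form_bil_commute[of v u])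

lemma form_val_diff:
  assumes "u \<in> form_dom E" "v \<in> form_dom E"
  shows "form_val E (\<lambda>x. u x - v x) = form_val E u - 2 * form_bil E u v + form_val E v"
  using assms by (simp add: form_val_def form_bil_bilinear form_dom_closed form_bil_commute[of v u])

lemma form_val_scale:
  assumes "u \<in> form_dom E"
  shows "form_val E (\<lambda>x. a * u x) = a\<^sup>2 * form_val E u"
  using assms by (simp add: form_val_def form_bil_bilinear form_dom_closed power2_eq_square)

text \<open>
  The form may be degenerate. When \<open>E[u] = 0\<close>, nonnegativity of \<open>E[v - t u]\<close> for all \<open>t\<close> forces
  \<open>E(u, v) = 0\<close>; otherwise the minimizing value of \<open>t\<close> gives the inequality.
\<close>

lemma form_Cauchy_Schwarz:
  assumes u: "u \<in> form_dom E" and v: "v \<in> form_dom E"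
  shows "(form_bil E u v)\<^sup>2 \<le> form_val E u * form_val E v"
proof -
  have q: "0 \<le> form_val E u * (t * t) - 2 * t * form_bil E u v + form_val E v" for t
  proof -
    have "0 \<le> form_val E (\<lambda>x. v x - t * u x)"
      using u v by (simp add: form_val_nonneg form_dom_closed)
    also have "\<dots> = form_val E u * (t * t) - 2 * t * form_bil E u v + form_val E v"
      using u v by (simp add: form_val_diff form_dom_closed form_val_scale form_bil_bilinear
          form_bil_commute[of v u] power2_eq_square algebra_simps)
    finally show ?thesis .
  qed
  show ?thesis
  proof (cases "form_val E u = 0")
    case True
    have "form_bil E u v = 0"
    proof (rule ccontr)
      assume "form_bil E u v \<noteq> 0"
      then show False
        using q[of "(form_val E v + 1) / (2 * form_bil E u v)"] True by simp
    qed
    then show ?thesis using True by simp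
  next
    case False
    then have pos: "form_val E u > 0" using form_val_nonneg[OF u] by simp
    have "0 \<le> form_val E u *
        (form_val E u * ((form_bil E u v / form_val E u) * (form_bil E u v / form_val E u))
        - 2 * (form_bil E u v / form_val E u) * form_bil E u v + form_val E v)"
      using q[of "form_bil E u v / form_val E u"] pos by (intro mult_nonneg_nonneg) auto
    also have "\<dots> = form_val E u * form_val E v - (form_bil E u v)\<^sup>2"
      using pos by (simp add: field_simps power2_eq_square)
    finally show ?thesis by simp
  qed
qed

lemma form_bil_le_sqrt:
  assumes u: "u \<in> form_dom E" and v: "v \<in> form_dom E"
  shows "\<bar>form_bil E u v\<bar> \<le> sqrt (form_val E u) * sqrt (form_val E v)"
  using form_Cauchy_Schwarz[OF u v] by (metis real_sqrt_abs real_sqrt_le_iff real_sqrt_mult)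

lemma form_bil_tendsto:
  assumes U: "\<And>n. U n \<in> form_dom E" and u: "u \<in> form_dom E" and v: "v \<in> form_dom E"
    and lim: "((\<lambda>n. form_val E (\<lambda>x. U n x - u x)) \<longlongrightarrow> 0) F"
  shows "((\<lambda>n. form_bil E (U n) v) \<longlongrightarrow> form_bil E u v) F"
proof -
  have "((\<lambda>n. form_bil E (U n) v - form_bil E u v) \<longlongrightarrow> 0) F"
  proof (rule Lim_null_comparison)
    show "\<forall>\<^sub>F n in F. norm (form_bil E (U n) v - form_bil E u v) \<le>
        sqrt (form_val E (\<lambda>x. U n x - u x)) * sqrt (form_val E v)"
      using form_bil_le_sqrt[OF form_dom_diff[OF U u] v] U u v
      by (simp add: form_bil_diff_left)
    have "((\<lambda>n. sqrt (form_val E (\<lambda>x. U n x - u x)) * sqrt (form_val E v)) \<longlongrightarrow>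
        sqrt 0 * sqrt (form_val E v)) F"
      by (intro tendsto_intros lim)
    then show "((\<lambda>n. sqrt (form_val E (\<lambda>x. U n x - u x)) * sqrt (form_val E v)) \<longlongrightarrow> 0) F"
      by simp
  qed
  then show ?thesis by (simp add: LIM_zero_iff)
qed

end

section \<open>The Hilbert space of square-integrable functions\<close>

lemma L2_mult_integrable:
  assumes "u \<in> L2 M" "v \<in> L2 M"
  shows "integrable M (\<lambda>x. u x * v x)"
proof (rule Bochner_Integration.integrable_bound)
  show "integrable M (\<lambda>x. (u x)\<^sup>2 + (v x)\<^sup>2)"
    using assms by (auto simp: L2_def)
  show "(\<lambda>x. u x * v x) \<in> borel_measurable M"
    using assms by (auto simp: L2_def)
  have "\<bar>a * b\<bar> \<le> a\<^sup>2 + b\<^sup>2" for a b :: real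
  proof -
    have "2 * (\<bar>a\<bar> * \<bar>b\<bar>) \<le> a\<^sup>2 + b\<^sup>2"
      using sum_squares_bound[of "\<bar>a\<bar>" "\<bar>b\<bar>"] by simp
    moreover have "0 \<le> \<bar>a\<bar> * \<bar>b\<bar>" by simp
    ultimately show ?thesis unfolding abs_mult by linarith
  qed
  then show "AE x in M. norm (u x * v x) \<le> norm ((u x)\<^sup>2 + (v x)\<^sup>2)"
    by simp
qed

lemma L2_lincomb:
  assumes "u \<in> L2 M" "v \<in> L2 M"
  shows "(\<lambda>x. a * u x + b * v x) \<in> L2 M"
proof -
  have "integrable M (\<lambda>x. a\<^sup>2 * (u x)\<^sup>2 + (2 * a * b) * (u x * v x) + b\<^sup>2 * (v x)\<^sup>2)"
    using assms L2_mult_integrable[OF assms] by (auto simp: L2_def)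
  then have "integrable M (\<lambda>x. (a * u x + b * v x)\<^sup>2)"
    by (rule back_subst[of "integrable M"]) (simp add: fun_eq_iff power2_eq_square algebra_simps)
  then show ?thesis using assms by (auto simp: L2_def)
qed

text \<open>
  The inner product of \<open>L\<^sup>2\<close> is itself a nonnegative quadratic form, so the algebra above, including
  the Cauchy-Schwarz inequality, applies to it.
\<close>

definition l2_form :: "'a measure \<Rightarrow> 'a qform" where
  "l2_form M = \<lparr>form_dom = L2 M, form_bil = l2_inner M\<rparr>"

lemma l2_form_simps [simp]: "form_dom (l2_form M) = L2 M" "form_bil (l2_form M) = l2_inner M"
  by (simp_all add: l2_form_def)

lemma l2_inner_cong_AE:
  assumes "u \<in> L2 M" "u' \<in> L2 M" "v \<in> L2 M" "v' \<in> L2 M"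
    and "AE x in M. u x = u' x" "AE x in M. v x = v' x"
  shows "l2_inner M u v = l2_inner M u' v'"
  unfolding l2_inner_def
proof (rule integral_cong_AE)
  show "(\<lambda>x. u x * v x) \<in> borel_measurable M" "(\<lambda>x. u' x * v' x) \<in> borel_measurable M"
    using assms by (auto simp: L2_def)
  show "AE x in M. u x * v x = u' x * v' x"
    using assms(5,6) by eventually_elim simp
qed

lemma nonneg_quadratic_form_l2: "nonneg_quadratic_form M (l2_form M)"
  unfolding nonneg_quadratic_form_def l2_form_simps
proof (intro conjI ballI allI impI)
  fix u v w a b assume uvw: "u \<in> L2 M" "v \<in> L2 M" "w \<in> L2 M"
  have "l2_inner M (\<lambda>x. a * u x + b * v x) w = (\<integral>x. a * (u x * w x) + b * (v x * w x) \<partial>M)"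
    by (simp add: l2_inner_def algebra_simps)
  also have "\<dots> = a * l2_inner M u w + b * l2_inner M v w"
    using L2_mult_integrable[OF uvw(1,3)] L2_mult_integrable[OF uvw(2,3)]
    by (simp add: l2_inner_def)
  finally show "l2_inner M (\<lambda>x. a * u x + b * v x) w = a * l2_inner M u w + b * l2_inner M v w" .
next
  show "(\<lambda>x. 0) \<in> L2 M" by (simp add: L2_def)
next
  fix u v w assume "u \<in> L2 M" "v \<in> L2 M" "AE x in M. u x = v x" "w \<in> L2 M"
  then show "l2_inner M v w = l2_inner M u w"
    by (intro l2_inner_cong_AE) (auto elim: eventually_mono)
qed (auto simp: L2_lincomb form_val_def l2_inner_def mult.commute)

lemmas L2_diff = form_dom_diff[OF nonneg_quadratic_form_l2, simplified]
  and L2_add = form_dom_add[OF nonneg_quadratic_form_l2, simplified]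
  and L2_scale = form_dom_scale[OF nonneg_quadratic_form_l2, simplified]
  and L2_zero = form_dom_zero[OF nonneg_quadratic_form_l2, simplified]

lemmas l2_inner_commute = form_bil_commute[OF nonneg_quadratic_form_l2, simplified]
  and l2_inner_bilinear = form_bil_bilinear[OF nonneg_quadratic_form_l2, simplified]

lemma form_val_l2: "u \<in> L2 M \<Longrightarrow> form_val (l2_form M) u = (l2_norm M u)\<^sup>2"
  using form_val_nonneg[OF nonneg_quadratic_form_l2, of u]
  by (simp add: l2_norm_def form_val_def)

lemma l2_inner_self: "u \<in> L2 M \<Longrightarrow> l2_inner M u u = (l2_norm M u)\<^sup>2"
  using form_val_l2 by (simp add: form_val_def)

lemma l2_norm_nonneg [simp]: "0 \<le> l2_norm M u"
  by (simp add: l2_norm_def l2_inner_def)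

lemma l2_Cauchy_Schwarz:
  "u \<in> L2 M \<Longrightarrow> v \<in> L2 M \<Longrightarrow> \<bar>l2_inner M u v\<bar> \<le> l2_norm M u * l2_norm M v"
  using form_bil_le_sqrt[OF nonneg_quadratic_form_l2, of u M v]
  by (simp add: form_val_l2)

lemma l2_norm_add_sq:
  "u \<in> L2 M \<Longrightarrow> v \<in> L2 M \<Longrightarrow>
    (l2_norm M (\<lambda>x. u x + v x))\<^sup>2 = (l2_norm M u)\<^sup>2 + 2 * l2_inner M u v + (l2_norm M v)\<^sup>2"
  using form_val_add[OF nonneg_quadratic_form_l2, of u M v] by (simp add: form_val_l2 L2_add)

lemma l2_norm_diff_sq:
  "u \<in> L2 M \<Longrightarrow> v \<in> L2 M \<Longrightarrow>
    (l2_norm M (\<lambda>x. u x - v x))\<^sup>2 = (l2_norm M u)\<^sup>2 - 2 * l2_inner M u v + (l2_norm M v)\<^sup>2"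
  using form_val_diff[OF nonneg_quadratic_form_l2, of u M v] by (simp add: form_val_l2 L2_diff)

lemma l2_norm_scale: "l2_norm M (\<lambda>x. a * u x) = \<bar>a\<bar> * l2_norm M u"
proof -
  have "l2_inner M (\<lambda>x. a * u x) (\<lambda>x. a * u x) = (\<integral>x. a\<^sup>2 * (u x * u x) \<partial>M)"
    by (simp add: l2_inner_def power2_eq_square algebra_simps)
  also have "\<dots> = a\<^sup>2 * l2_inner M u u" by (simp add: l2_inner_def)
  finally show ?thesis by (simp add: l2_norm_def real_sqrt_mult)
qed

lemma l2_norm_commute: "l2_norm M (\<lambda>x. u x - v x) = l2_norm M (\<lambda>x. v x - u x)"
  using l2_norm_scale[of M "-1" "\<lambda>x. v x - u x"] by simp

lemma l2_norm_triangle: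
  assumes "u \<in> L2 M" "v \<in> L2 M"
  shows "l2_norm M (\<lambda>x. u x + v x) \<le> l2_norm M u + l2_norm M v"
proof (rule power2_le_imp_le)
  show "(l2_norm M (\<lambda>x. u x + v x))\<^sup>2 \<le> (l2_norm M u + l2_norm M v)\<^sup>2"
    using l2_norm_add_sq[OF assms] l2_Cauchy_Schwarz[OF assms] by (simp add: power2_sum)
qed simp

lemma l2_norm_triangle_diff:
  assumes "u \<in> L2 M" "v \<in> L2 M" "w \<in> L2 M"
  shows "l2_norm M (\<lambda>x. u x - w x) \<le> l2_norm M (\<lambda>x. u x - v x) + l2_norm M (\<lambda>x. v x - w x)"
  using l2_norm_triangle[OF L2_diff[OF assms(1,2)] L2_diff[OF assms(2,3)]] by simp

lemma l2_norm_diff_le: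
  assumes "u \<in> L2 M" "v \<in> L2 M"
  shows "l2_norm M (\<lambda>x. u x - v x) \<le> l2_norm M u + l2_norm M v"
  using l2_norm_triangle[OF assms(1) L2_scale[OF assms(2), of "-1"]] l2_norm_scale[of M "-1" v]
  by simp

lemma l2_norm_cong_AE:
  assumes "u \<in> L2 M" "v \<in> L2 M" "AE x in M. u x = v x"
  shows "l2_norm M u = l2_norm M v"
  using l2_inner_cong_AE[OF assms(1,2,1,2,3,3)] by (simp add: l2_norm_def)

lemma l2_norm_eq_0_iff:
  assumes "u \<in> L2 M"
  shows "l2_norm M u = 0 \<longleftrightarrow> (AE x in M. u x = 0)"
proof -
  have "l2_norm M u = 0 \<longleftrightarrow> (\<integral>x. u x * u x \<partial>M) = 0"
    by (simp add: l2_norm_def l2_inner_def)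
  also have "\<dots> \<longleftrightarrow> (AE x in M. u x * u x = 0)"
    using L2_mult_integrable[OF assms assms] by (intro integral_nonneg_eq_0_iff_AE) auto
  finally show ?thesis by simp
qed

lemma l2_dist_eq_0_iff:
  assumes "u \<in> L2 M" "v \<in> L2 M"
  shows "l2_norm M (\<lambda>x. u x - v x) = 0 \<longleftrightarrow> (AE x in M. u x = v x)"
  using l2_norm_eq_0_iff[OF L2_diff[OF assms]] by simp

lemma l2_tendsto_imp_weak:
  assumes U: "\<And>n. U n \<in> L2 M" and u: "u \<in> L2 M" and lim: "l2_tendsto M U u F"
  shows "l2_weak_tendsto M U u F"
  unfolding l2_weak_tendsto_def
proof
  fix v assume v: "v \<in> L2 M"
  have "((\<lambda>n. (l2_norm M (\<lambda>x. U n x - u x))\<^sup>2) \<longlongrightarrow> 0\<^sup>2) F"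
    using lim unfolding l2_tendsto_def by (intro tendsto_intros)
  then show "((\<lambda>n. l2_inner M (U n) v) \<longlongrightarrow> l2_inner M u v) F"
    using form_bil_tendsto[OF nonneg_quadratic_form_l2, of U M u v F] U u v
    by (simp add: form_val_l2 L2_diff)
qed

lemma nn_integral_sq_L2:
  assumes "u \<in> L2 M"
  shows "(\<integral>\<^sup>+x. ennreal ((u x)\<^sup>2) \<partial>M) = ennreal ((l2_norm M u)\<^sup>2)"
proof -
  have "(\<integral>\<^sup>+x. ennreal ((u x)\<^sup>2) \<partial>M) = ennreal (\<integral>x. (u x)\<^sup>2 \<partial>M)"
    using assms by (intro nn_integral_eq_integral) (auto simp: L2_def)
  then show ?thesis
    using l2_inner_self[OF assms] by (simp add: l2_inner_def power2_eq_square)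
qed

text \<open>
  The argument of Riesz and Fischer. Along a subsequence with consecutive distances at most
  \<open>2\<^sup>-\<^sup>k\<close> the increments \<open>d\<^sub>k\<close> satisfy \<open>\<Sum> 2\<^sup>k \<parallel>d\<^sub>k\<parallel>\<^sup>2 < \<infinity>\<close>, so \<open>\<Sum> 2\<^sup>k d\<^sub>k\<^sup>2\<close> is finite almost
  everywhere. As \<open>2 \<bar>d\<^sub>k\<bar> \<le> 2\<^sup>-\<^sup>k + 2\<^sup>k d\<^sub>k\<^sup>2\<close>, the subsequence converges almost everywhere, and Fatou's
  lemma turns the Cauchy property into convergence in norm.
\<close>

lemma L2_complete:
  assumes U: "\<And>n. U n \<in> L2 M"
    and Cauchy: "\<And>e. e > 0 \<Longrightarrow> \<exists>N. \<forall>m\<ge>N. \<forall>n\<ge>N. l2_norm M (\<lambda>x. U m x - U n x) < e"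
  obtains u where "u \<in> L2 M" "l2_tendsto M U u sequentially"
proof -
  have "\<exists>N. \<forall>k. \<forall>m\<ge>N k. \<forall>n\<ge>N k. l2_norm M (\<lambda>x. U m x - U n x) < (1/2)^k"
    using Cauchy by (intro choice allI) simp
  then obtain N where N: "\<And>k m n. m \<ge> N k \<Longrightarrow> n \<ge> N k \<Longrightarrow>
      l2_norm M (\<lambda>x. U m x - U n x) < (1/2)^k"
    by blast
  \<comment> \<open>a nondecreasing choice of indices that dominates both \<open>N k\<close> and \<open>k\<close>\<close>
  define r where "r k = (\<Sum>j\<le>k. N j) + k" for k
  have rN: "r k \<ge> N k" and r_Suc: "r (Suc k) \<ge> r k" and r_ge: "r k \<ge> k" for k
  proof -
    have "N k \<le> (\<Sum>j\<le>k. N j)" by (intro member_le_sum) auto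
    then show "r k \<ge> N k" "r (Suc k) \<ge> r k" "r k \<ge> k" by (auto simp: r_def)
  qed
  define d where "d k x = U (r (Suc k)) x - U (r k) x" for k x
  have d_L2: "d k \<in> L2 M" for k
    unfolding d_def using U by (simp add: L2_diff)
  have d_norm: "l2_norm M (d k) \<le> (1/2)^k" for k
    unfolding d_def using N[of k "r (Suc k)" "r k"] rN[of k] r_Suc[of k] by simp
  have meas [measurable]: "U n \<in> borel_measurable M" "d n \<in> borel_measurable M" for n
    using U d_L2 by (auto simp: L2_def)
  have AE_fin: "AE x in M. (\<Sum>k. ennreal (2^k * (d k x)\<^sup>2)) \<noteq> \<infinity>"
  proof (rule nn_integral_PInf_AE)
    show "(\<lambda>x. \<Sum>k. ennreal (2^k * (d k x)\<^sup>2)) \<in> borel_measurable M" by measurable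
    have "(\<integral>\<^sup>+x. (\<Sum>k. ennreal (2^k * (d k x)\<^sup>2)) \<partial>M)
        = (\<Sum>k. \<integral>\<^sup>+x. ennreal (2^k) * ennreal ((d k x)\<^sup>2) \<partial>M)"
      by (subst nn_integral_suminf) (auto simp: ennreal_mult)
    also have "\<dots> = (\<Sum>k. ennreal (2^k * (l2_norm M (d k))\<^sup>2))"
      by (subst nn_integral_cmult) (auto simp: nn_integral_sq_L2[OF d_L2] ennreal_mult)
    also have "\<dots> \<le> (\<Sum>k. ennreal ((1/2)^k))"
    proof (intro suminf_le ennreal_leI)
      fix k
      have "2^k * (l2_norm M (d k))\<^sup>2 \<le> 2^k * ((1/2)^k)\<^sup>2"
        using d_norm by (intro mult_left_mono power_mono) auto
      also have "\<dots> = (1/2::real)^k"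
        by (simp add: power2_eq_square power_one_over)
      finally show "2^k * (l2_norm M (d k))\<^sup>2 \<le> (1/2)^k" .
    qed auto
    also have "\<dots> = ennreal (\<Sum>k. (1/2)^k)"
      by (intro suminf_ennreal2) (auto intro: summable_geometric)
    finally show "(\<integral>\<^sup>+x. (\<Sum>k. ennreal (2^k * (d k x)\<^sup>2)) \<partial>M) \<noteq> \<infinity>"
      by (auto simp: top_unique)
  qed
  have AE_conv: "AE x in M. convergent (\<lambda>k. U (r k) x)"
    using AE_fin
  proof eventually_elim
    case (elim x)
    have summ: "summable (\<lambda>k. 2^k * (d k x)\<^sup>2)"
      using elim by (intro summable_suminf_not_top) (auto simp: top_unique)
    have "summable (\<lambda>k. (1/2)^k + 2^k * (d k x)\<^sup>2)"
      by (intro summable_add summ summable_geometric) simp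
    then have "summable (\<lambda>k. d k x)"
    proof (rule summable_comparison_test'[where N = 0])
      fix k
      have "2 * \<bar>d k x\<bar> \<le> (1/2)^k + 2^k * (d k x)\<^sup>2"
      proof -
        have "0 \<le> (1/2)^k * (1 - 2^k * \<bar>d k x\<bar>)\<^sup>2" by simp
        also have "\<dots> = (1/2)^k - 2 * \<bar>d k x\<bar> + 2^k * (d k x)\<^sup>2"
          by (simp add: power2_eq_square field_simps power_one_over abs_if)
        finally show ?thesis by simp
      qed
      then show "norm (d k x) \<le> (1/2)^k + 2^k * (d k x)\<^sup>2" by simp
    qed
    then have "convergent (\<lambda>n. \<Sum>k<n. d k x)"
      by (simp add: summable_iff_convergent)
    then have "convergent (\<lambda>n. (\<Sum>k<n. d k x) + U (r 0) x)"
      by (simp add: convergent_add convergent_const)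
    moreover have "(\<Sum>k<n. d k x) + U (r 0) x = U (r n) x" for n
      unfolding d_def using sum_lessThan_telescope[of "\<lambda>k. U (r k) x" n] by simp
    ultimately show ?case by simp
  qed
  define u where "u x = lim (\<lambda>k. U (r k) x)" for x
  have u_meas [measurable]: "u \<in> borel_measurable M"
    unfolding u_def by measurable
  have AE_lim: "AE x in M. (\<lambda>k. U (r k) x) \<longlonglongrightarrow> u x"
    using AE_conv by eventually_elim (simp add: u_def convergent_LIMSEQ_iff)
  have fatou: "(\<integral>\<^sup>+x. ennreal ((U n x - u x)\<^sup>2) \<partial>M) \<le> ennreal (e\<^sup>2)"
    if e: "e > 0" and n: "\<And>m. m \<ge> n \<Longrightarrow> l2_norm M (\<lambda>x. U n x - U m x) \<le> e" for n e
  proof -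
    have "(\<integral>\<^sup>+x. ennreal ((U n x - u x)\<^sup>2) \<partial>M)
        = (\<integral>\<^sup>+x. liminf (\<lambda>k. ennreal ((U n x - U (r k) x)\<^sup>2)) \<partial>M)"
    proof (rule nn_integral_cong_AE)
      show "AE x in M. ennreal ((U n x - u x)\<^sup>2) = liminf (\<lambda>k. ennreal ((U n x - U (r k) x)\<^sup>2))"
        using AE_lim
      proof eventually_elim
        case (elim x)
        have "(\<lambda>k. ennreal ((U n x - U (r k) x)\<^sup>2)) \<longlonglongrightarrow> ennreal ((U n x - u x)\<^sup>2)"
          by (intro tendsto_intros elim)
        then show ?case by (intro lim_imp_Liminf[symmetric]) auto
      qed
    qed
    also have "\<dots> \<le> liminf (\<lambda>k. \<integral>\<^sup>+x. ennreal ((U n x - U (r k) x)\<^sup>2) \<partial>M)"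
      by (intro nn_integral_liminf) measurable
    also have "\<dots> = liminf (\<lambda>k. ennreal ((l2_norm M (\<lambda>x. U n x - U (r k) x))\<^sup>2))"
      by (simp add: nn_integral_sq_L2 L2_diff U)
    also have "\<dots> \<le> liminf (\<lambda>k::nat. ennreal (e\<^sup>2))"
    proof (rule Liminf_mono, rule eventually_sequentiallyI[of n])
      fix k assume "n \<le> k"
      then have "l2_norm M (\<lambda>x. U n x - U (r k) x) \<le> e"
        using n r_ge[of k] by simp
      then show "ennreal ((l2_norm M (\<lambda>x. U n x - U (r k) x))\<^sup>2) \<le> ennreal (e\<^sup>2)"
        by (intro ennreal_leI power_mono) auto
    qed
    also have "\<dots> = ennreal (e\<^sup>2)" by (simp add: Liminf_const)
    finally show ?thesis .
  qed
  have diff_L2: "(\<lambda>x. U n x - u x) \<in> L2 M" and diff_norm: "l2_norm M (\<lambda>x. U n x - u x) \<le> e"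
    if e: "e > 0" and n: "\<And>m. m \<ge> n \<Longrightarrow> l2_norm M (\<lambda>x. U n x - U m x) \<le> e" for n e
  proof -
    have fin: "(\<integral>\<^sup>+x. ennreal ((U n x - u x)\<^sup>2) \<partial>M) \<le> ennreal (e\<^sup>2)"
      by (rule fatou[OF that])
    also have "\<dots> < \<infinity>" by simp
    finally have "integrable M (\<lambda>x. (U n x - u x)\<^sup>2)"
      by (intro integrableI_bounded) auto
    then show L: "(\<lambda>x. U n x - u x) \<in> L2 M" by (auto simp: L2_def)
    have "(l2_norm M (\<lambda>x. U n x - u x))\<^sup>2 \<le> e\<^sup>2"
      using fin nn_integral_sq_L2[OF L] by simp
    then show "l2_norm M (\<lambda>x. U n x - u x) \<le> e"
      by (rule power2_le_imp_le) (use e in simp)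
  qed
  have "(\<lambda>x. U (N 0) x - u x) \<in> L2 M"
    using N[where k = 0 and m = "N 0"] by (intro diff_L2[of 1]) (auto intro: less_imp_le)
  from L2_diff[OF U[of "N 0"] this] have u_L2: "u \<in> L2 M" by simp
  have "l2_tendsto M U u sequentially"
    unfolding l2_tendsto_def
  proof (rule LIMSEQ_I)
    fix e :: real assume "e > 0"
    then obtain N' where N': "\<forall>m\<ge>N'. \<forall>n\<ge>N'. l2_norm M (\<lambda>x. U m x - U n x) < e/2"
      using Cauchy[of "e/2"] by auto
    have "l2_norm M (\<lambda>x. U n x - u x) \<le> e/2" if "n \<ge> N'" for n
      using that N' \<open>e > 0\<close> by (intro diff_norm) (auto intro: less_imp_le)
    then show "\<exists>no. \<forall>n\<ge>no. norm (l2_norm M (\<lambda>x. U n x - u x) - 0) < e"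
      using \<open>e > 0\<close> by (intro exI[of _ N']) fastforce
  qed
  then show ?thesis using u_L2 that by blast
qed

section \<open>Multiplication by an indicator function\<close>

definition cut :: "'a set \<Rightarrow> ('a \<Rightarrow> real) \<Rightarrow> 'a \<Rightarrow> real" where
  "cut Y u = (\<lambda>x. indicator Y x * u x)"

lemma cut_L2: "Y \<in> sets M \<Longrightarrow> u \<in> L2 M \<Longrightarrow> cut Y u \<in> L2 M"
proof -
  assume Y: "Y \<in> sets M" and u: "u \<in> L2 M"
  then have [measurable]: "Y \<in> sets M" "u \<in> borel_measurable M" by (auto simp: L2_def)
  have "integrable M (\<lambda>x. (cut Y u x)\<^sup>2)"
  proof (rule Bochner_Integration.integrable_bound)
    show "integrable M (\<lambda>x. (u x)\<^sup>2)" using u by (simp add: L2_def)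
    show "(\<lambda>x. (cut Y u x)\<^sup>2) \<in> borel_measurable M" unfolding cut_def by measurable
  qed (auto simp: cut_def indicator_def)
  then show ?thesis using u by (auto simp: L2_def cut_def)
qed

lemma cut_apply: "cut Y u x = indicator Y x * u x"
  by (simp add: cut_def)

lemma cut_diff: "cut Y (\<lambda>x. u x - v x) = (\<lambda>x. cut Y u x - cut Y v x)"
  by (simp add: cut_def fun_eq_iff algebra_simps)

lemma cut_cut [simp]: "cut Y (cut Y u) = cut Y u"
  by (simp add: cut_def fun_eq_iff indicator_def)

lemma l2_inner_cut: "l2_inner M (cut Y u) v = l2_inner M u (cut Y v)"
  by (simp add: l2_inner_def cut_def algebra_simps)

lemma l2_norm_cut_le:
  assumes Y: "Y \<in> sets M" and u: "u \<in> L2 M"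
  shows "l2_norm M (cut Y u) \<le> l2_norm M u"
  unfolding l2_norm_def l2_inner_def
proof (intro real_sqrt_le_mono integral_mono)
  show "integrable M (\<lambda>x. cut Y u x * cut Y u x)" "integrable M (\<lambda>x. u x * u x)"
    using cut_L2[OF Y u] u L2_mult_integrable by auto
qed (auto simp: cut_def indicator_def)

lemma l2_tendsto_cut:
  assumes Y: "Y \<in> sets M" and U: "\<And>i. U i \<in> L2 M" and u: "u \<in> L2 M" and lim: "l2_tendsto M U u F"
  shows "l2_tendsto M (\<lambda>i. cut Y (U i)) (cut Y u) F"
  unfolding l2_tendsto_def
proof (rule Lim_null_comparison)
  show "((\<lambda>i. l2_norm M (\<lambda>x. U i x - u x)) \<longlongrightarrow> 0) F"
    using lim by (simp add: l2_tendsto_def)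
  show "\<forall>\<^sub>F i in F. norm (l2_norm M (\<lambda>x. cut Y (U i) x - cut Y u x)) \<le>
      l2_norm M (\<lambda>x. U i x - u x)"
    using l2_norm_cut_le[OF Y L2_diff[OF U u]] by (simp add: cut_diff)
qed

section \<open>Semigroups commuting with the indicator\<close>

lemma invariant_set_iff_cut:
  "invariant_set M S Y \<longleftrightarrow>
    Y \<in> sets M \<and> (\<forall>u\<in>L2 M. AE x in M. S (cut Y u) x = cut Y (S u) x)"
  by (simp add: invariant_set_def cut_def)

context
  fixes M :: "'a measure" and T :: "real \<Rightarrow> ('a \<Rightarrow> real) \<Rightarrow> 'a \<Rightarrow> real"
  assumes sg: "contraction_semigroup M T"
begin

lemma semigroup_L2: "t > 0 \<Longrightarrow> u \<in> L2 M \<Longrightarrow> T t u \<in> L2 M"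
  using sg by (simp add: contraction_semigroup_def)

lemma semigroup_symmetric:
  "t > 0 \<Longrightarrow> u \<in> L2 M \<Longrightarrow> v \<in> L2 M \<Longrightarrow> l2_inner M (T t u) v = l2_inner M u (T t v)"
  using sg by (simp add: contraction_semigroup_def)

lemma semigroup_contraction: "t > 0 \<Longrightarrow> u \<in> L2 M \<Longrightarrow> l2_norm M (T t u) \<le> l2_norm M u"
  using sg by (simp add: contraction_semigroup_def)

lemma semigroup_add:
  "s > 0 \<Longrightarrow> t > 0 \<Longrightarrow> u \<in> L2 M \<Longrightarrow> AE x in M. T (s + t) u x = T s (T t u) x"
  using sg by (simp add: contraction_semigroup_def)

lemma semigroup_lincomb:
  "t > 0 \<Longrightarrow> u \<in> L2 M \<Longrightarrow> v \<in> L2 M \<Longrightarrow>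
    AE x in M. T t (\<lambda>y. a * u y + b * v y) x = a * T t u x + b * T t v x"
  using sg by (simp add: contraction_semigroup_def)

lemma semigroup_diff:
  "t > 0 \<Longrightarrow> u \<in> L2 M \<Longrightarrow> v \<in> L2 M \<Longrightarrow>
    AE x in M. T t (\<lambda>y. u y - v y) x = T t u x - T t v x"
  using semigroup_lincomb[of t u v 1 "-1"] by simp

lemma semigroup_scale:
  "t > 0 \<Longrightarrow> u \<in> L2 M \<Longrightarrow> AE x in M. T t (\<lambda>y. a * u y) x = a * T t u x"
  using semigroup_lincomb[of t u u a 0] by simp

lemma semigroup_strong_continuity: "u \<in> L2 M \<Longrightarrow> l2_tendsto M (\<lambda>t. T t u) u (at_right 0)"
  using sg by (simp add: contraction_semigroup_def)

lemma semigroup_dist_le: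
  assumes t: "t > 0" and u: "u \<in> L2 M" and v: "v \<in> L2 M"
  shows "l2_norm M (\<lambda>x. T t u x - T t v x) \<le> l2_norm M (\<lambda>x. u x - v x)"
proof -
  have "l2_norm M (\<lambda>x. T t u x - T t v x) = l2_norm M (T t (\<lambda>x. u x - v x))"
    using semigroup_diff[OF t u v]
    by (intro l2_norm_cong_AE) (auto simp: L2_diff semigroup_L2 t u v elim: eventually_mono)
  then show ?thesis
    using semigroup_contraction[OF t L2_diff[OF u v]] by simp
qed

lemma semigroup_cong_AE:
  assumes t: "t > 0" and u: "u \<in> L2 M" and v: "v \<in> L2 M" and eq: "AE x in M. u x = v x"
  shows "AE x in M. T t u x = T t v x"
proof -
  have "l2_norm M (\<lambda>x. u x - v x) = 0"
    using eq l2_dist_eq_0_iff[OF u v] by simp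
  then have "l2_norm M (\<lambda>x. T t u x - T t v x) = 0"
    using semigroup_dist_le[OF t u v] l2_norm_nonneg[of M "\<lambda>x. T t u x - T t v x"] by linarith
  then show ?thesis
    using l2_dist_eq_0_iff[OF semigroup_L2[OF t u] semigroup_L2[OF t v]] by simp
qed

lemma semigroup_swap:
  assumes "s > 0" "t > 0" "u \<in> L2 M"
  shows "AE x in M. T s (T t u) x = T t (T s u) x"
  using semigroup_add[OF assms] semigroup_add[OF assms(2,1,3)]
  by eventually_elim (simp add: add.commute)

lemma semigroup_inner_double:
  assumes t: "t > 0" and u: "u \<in> L2 M"
  shows "l2_inner M (T (t + t) u) u = (l2_norm M (T t u))\<^sup>2"
proof -
  have "l2_inner M (T (t + t) u) u = l2_inner M (T t (T t u)) u"
    using semigroup_add[OF t t u] t u by (intro l2_inner_cong_AE) (auto simp: semigroup_L2)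
  also have "\<dots> = l2_inner M (T t u) (T t u)"
    using t u by (simp add: semigroup_symmetric semigroup_L2)
  finally show ?thesis using t u by (simp add: l2_inner_self semigroup_L2)
qed

text \<open>
  If \<open>T\<^sub>s u = 0\<close> then \<open>\<parallel>T\<^sub>s\<^sub>/\<^sub>2 u\<parallel>\<^sup>2 = \<langle>T\<^sub>s u, u\<rangle> = 0\<close>. Halving repeatedly, \<open>T\<close> kills \<open>u\<close> at times
  tending to \<open>0\<close>, where \<open>T\<close> tends strongly to the identity.
\<close>

lemma semigroup_injective:
  assumes t: "t > 0" and u: "u \<in> L2 M" and zero: "AE x in M. T t u x = 0"
  shows "AE x in M. u x = 0"
proof -
  have half: "AE x in M. T (s/2) u x = 0" if s: "s > 0" "AE x in M. T s u x = 0" for s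
  proof -
    have "(l2_norm M (T (s/2) u))\<^sup>2 = l2_inner M (T s u) u"
      using semigroup_inner_double[of "s/2" u] s u by simp
    also have "\<dots> = l2_inner M (\<lambda>x. 0) u"
      using s u by (intro l2_inner_cong_AE) (auto simp: semigroup_L2 L2_zero)
    also have "\<dots> = 0" by (simp add: l2_inner_def)
    finally show ?thesis
      using s u l2_norm_eq_0_iff[OF semigroup_L2] by simp
  qed
  have z: "AE x in M. T (t / 2^n) u x = 0" for n
  proof (induction n)
    case (Suc n)
    then show ?case using half[of "t / 2^n"] t by (simp add: field_simps)
  qed (use zero in simp)
  have "(\<lambda>n. l2_norm M (\<lambda>x. T (t / 2^n) u x - u x)) \<longlonglongrightarrow> 0"
  proof (rule filterlim_compose[where f = "\<lambda>n. t / 2^n"])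
    show "((\<lambda>s. l2_norm M (\<lambda>x. T s u x - u x)) \<longlongrightarrow> 0) (at_right 0)"
      using semigroup_strong_continuity[OF u] by (simp add: l2_tendsto_def)
    have "(\<lambda>n. t * (1/2)^n) \<longlonglongrightarrow> t * 0"
      by (intro tendsto_intros LIMSEQ_power_zero) simp
    moreover have "(\<lambda>n. t * (1/2)^n) = (\<lambda>n. t / 2^n)"
      by (simp add: fun_eq_iff power_one_over)
    ultimately have "(\<lambda>n. t / 2^n) \<longlonglongrightarrow> 0" by simp
    then show "filterlim (\<lambda>n. t / 2^n) (at_right 0) sequentially"
      using t by (intro tendsto_imp_filterlim_at_right) (auto intro: always_eventually)
  qed
  moreover have "l2_norm M (\<lambda>x. T (t / 2^n) u x - u x) = l2_norm M u" for n
  proof -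
    have "l2_norm M (\<lambda>x. T (t / 2^n) u x - u x) = l2_norm M (\<lambda>x. - 1 * u x)"
    proof (rule l2_norm_cong_AE)
      show "(\<lambda>x. - 1 * u x) \<in> L2 M" by (rule L2_scale[OF u])
      show "(\<lambda>x. T (t / 2^n) u x - u x) \<in> L2 M" using t u by (simp add: L2_diff semigroup_L2)
      show "AE x in M. T (t / 2^n) u x - u x = - 1 * u x" using z[of n] by eventually_elim simp
    qed
    also have "\<dots> = l2_norm M u" unfolding l2_norm_scale by simp
    finally show ?thesis .
  qed
  ultimately have "l2_norm M u = 0" by (simp add: LIMSEQ_const_iff)
  then show ?thesis using l2_norm_eq_0_iff[OF u] by simp
qed

text \<open>
  \<open>T\<^sub>t\<close> is a nonnegative contraction, being the square of \<open>T\<^sub>t\<^sub>/\<^sub>2\<close>; so \<open>1 - T\<^sub>t\<close> is a contraction too.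
\<close>

lemma semigroup_defect_le:
  assumes t: "t > 0" and u: "u \<in> L2 M"
  shows "l2_norm M (\<lambda>x. u x - T t u x) \<le> l2_norm M u"
proof -
  let ?w = "T (t/2) u"
  have w: "?w \<in> L2 M" using t u by (simp add: semigroup_L2)
  have "(l2_norm M (T t u))\<^sup>2 = (l2_norm M (T (t/2) ?w))\<^sup>2"
    using semigroup_add[of "t/2" "t/2" u] t u
    by (subst l2_norm_cong_AE[of _ _ "T (t/2) ?w"]) (auto simp: semigroup_L2)
  also have "\<dots> \<le> (l2_norm M ?w)\<^sup>2"
    using semigroup_contraction[of "t/2" ?w] t w by (intro power_mono) auto
  also have "\<dots> = l2_inner M u (T t u)"
    using semigroup_inner_double[of "t/2" u] t u l2_inner_commute[OF u semigroup_L2[OF t u]] by simp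
  finally have *: "(l2_norm M (T t u))\<^sup>2 \<le> l2_inner M u (T t u)" .
  have "(l2_norm M (\<lambda>x. u x - T t u x))\<^sup>2 \<le> (l2_norm M u)\<^sup>2"
    using l2_norm_diff_sq[OF u semigroup_L2[OF t u]] *
      zero_le_power2[of "l2_norm M (T t u)"] by linarith
  then show ?thesis by (rule power2_le_imp_le) simp
qed

text \<open>
  Let \<open>A = T\<^sub>s\<close> and \<open>B = [P, A]\<close>. Since \<open>P\<close> commutes with \<open>A\<^sup>2\<close>, \<open>B A = - A B\<close>, hence
  \<open>(1 + A)\<^sup>n B u = B (1 - A)\<^sup>n u\<close>. The right-hand side stays bounded, as \<open>1 - A\<close> is a contraction. Since
  \<open>A \<ge> 0\<close>, the left-hand side \<open>w\<^sub>n\<close> satisfies \<open>\<parallel>w\<^sub>n\<^sub>+\<^sub>1\<parallel>\<^sup>2 \<ge> \<parallel>w\<^sub>n\<parallel>\<^sup>2 + 2 \<langle>A w\<^sub>n, w\<^sub>n\<rangle>\<close> and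
  \<open>\<langle>A w\<^sub>n, w\<^sub>n\<rangle>\<close> is nondecreasing in \<open>n\<close>. So \<open>\<langle>A w\<^sub>0, w\<^sub>0\<rangle> = 0\<close>, that is \<open>T\<^sub>s\<^sub>/\<^sub>2 B u = 0\<close>, and \<open>B u = 0\<close> by
  injectivity.
\<close>

lemma invariant_set_half:
  assumes s: "s > 0" and inv: "invariant_set M (T (s + s)) Y"
  shows "invariant_set M (T s) Y"
  unfolding invariant_set_iff_cut
proof (intro conjI ballI)
  show Y: "Y \<in> sets M" using inv by (simp add: invariant_set_def)
  fix u assume u: "u \<in> L2 M"
  define B where "B v = (\<lambda>x. cut Y (T s v) x - T s (cut Y v) x)" for v
  have L2: "v \<in> L2 M \<Longrightarrow> T s v \<in> L2 M" "v \<in> L2 M \<Longrightarrow> cut Y v \<in> L2 M" "v \<in> L2 M \<Longrightarrow> B v \<in> L2 M" for v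
    using s Y by (auto simp: B_def semigroup_L2 cut_L2 L2_diff)
  have anti: "AE x in M. B (\<lambda>y. v y - T s v y) x = B v x + T s (B v) x" if v: "v \<in> L2 M" for v
  proof -
    have 1: "AE x in M. T s (\<lambda>y. v y - T s v y) x = T s v x - T s (T s v) x"
      using v s by (intro semigroup_diff L2) auto
    have 2: "AE x in M. T s (cut Y (\<lambda>y. v y - T s v y)) x = T s (cut Y v) x - T s (cut Y (T s v)) x"
      using v s unfolding cut_diff by (intro semigroup_diff L2) auto
    have 3: "AE x in M. T s (B v) x = T s (cut Y (T s v)) x - T s (T s (cut Y v)) x"
      using v s unfolding B_def by (intro semigroup_diff L2) auto
    have 4: "AE x in M. T (s + s) v x = T s (T s v) x"
        "AE x in M. T (s + s) (cut Y v) x = T s (T s (cut Y v)) x"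
      using v by (rule semigroup_add[OF s s], rule semigroup_add[OF s s L2(2)])
    have 5: "AE x in M. T (s + s) (cut Y v) x = cut Y (T (s + s) v) x"
      using inv v by (simp add: invariant_set_iff_cut)
    show ?thesis
      using 1 2 3 4 5
    proof eventually_elim
      case (elim x)
      have B: "B w x = indicator Y x * T s w x - T s (cut Y w) x" for w
        by (simp add: B_def cut_apply)
      have "T s (T s (cut Y v)) x = indicator Y x * T s (T s v) x"
        using elim(4,5,6) by (simp only: cut_apply)
      then show ?case
        using elim(3) by (simp add: B elim(1,2) cut_apply algebra_simps)
    qed
  qed
  define V where "V n = ((\<lambda>v x. v x - T s v x) ^^ n) u" for n
  have V_Suc: "V (Suc n) = (\<lambda>x. V n x - T s (V n) x)" and V_0: "V 0 = u" for n
    by (simp_all add: V_def)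
  have V_L2: "V n \<in> L2 M" for n
    by (induction n) (auto simp: V_Suc V_0 u L2_diff L2)
  have V_norm: "l2_norm M (V n) \<le> l2_norm M u" for n
  proof (induction n)
    case (Suc n)
    then show ?case using semigroup_defect_le[OF s V_L2[of n]] by (simp add: V_Suc)
  qed (simp add: V_0)
  define W where "W n = B (V n)" for n
  have W_L2: "W n \<in> L2 M" for n by (simp add: W_def L2 V_L2)
  have W_norm: "l2_norm M (W n) \<le> 2 * l2_norm M u" for n
  proof -
    have "l2_norm M (W n) \<le> l2_norm M (cut Y (T s (V n))) + l2_norm M (T s (cut Y (V n)))"
      unfolding W_def B_def by (intro l2_norm_diff_le L2 V_L2)
    also have "\<dots> \<le> l2_norm M (T s (V n)) + l2_norm M (cut Y (V n))"
      by (intro add_mono l2_norm_cut_le semigroup_contraction s Y L2 V_L2)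
    also have "\<dots> \<le> l2_norm M (V n) + l2_norm M (V n)"
      by (intro add_mono l2_norm_cut_le semigroup_contraction s Y L2 V_L2)
    finally show ?thesis using V_norm[of n] by simp
  qed
  have W_Suc: "AE x in M. W (Suc n) x = W n x + T s (W n) x" for n
    using anti[OF V_L2[of n]] by (simp add: W_def V_Suc)
  \<comment> \<open>the quadratic form \<open>\<langle>A w, w\<rangle>\<close>, written so that its sign is evident\<close>
  let ?q = "\<lambda>w. (l2_norm M (T (s/2) w))\<^sup>2"
  have q: "?q w = l2_inner M (T s w) w" if "w \<in> L2 M" for w
    using semigroup_inner_double[of "s/2" w] s that by simp
  have q_mono: "?q (W 0) \<le> ?q (W n)" for n
  proof (induction n)
    case (Suc n)
    let ?w = "W n" and ?A = "T (s/2)"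
    have w: "?w \<in> L2 M" "?A ?w \<in> L2 M" "T s ?w \<in> L2 M" "T s (?A ?w) \<in> L2 M" "?A (T s ?w) \<in> L2 M"
      using W_L2 s by (auto simp: semigroup_L2)
    have 1: "AE x in M. ?A (W (Suc n)) x = ?A (\<lambda>y. ?w y + T s ?w y) x"
      using s W_Suc[of n] w W_L2 by (intro semigroup_cong_AE) (auto simp: L2_add)
    have 2: "AE x in M. ?A (\<lambda>y. ?w y + T s ?w y) x = ?A ?w x + ?A (T s ?w) x"
      using semigroup_lincomb[of "s/2" ?w "T s ?w" 1 1] s w by simp
    have 3: "AE x in M. ?A (T s ?w) x = T s (?A ?w) x"
      using s w by (intro semigroup_swap) auto
    have "AE x in M. ?A (W (Suc n)) x = ?A ?w x + T s (?A ?w) x"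
      using 1 2 3 by eventually_elim simp
    then have "?q (W (Suc n)) = (l2_norm M (\<lambda>x. ?A ?w x + T s (?A ?w) x))\<^sup>2"
      using w W_L2 s by (subst l2_norm_cong_AE) (auto simp: L2_add semigroup_L2)
    also have "\<dots> = ?q ?w + 2 * l2_inner M (?A ?w) (T s (?A ?w)) + (l2_norm M (T s (?A ?w)))\<^sup>2"
      using w by (simp add: l2_norm_add_sq)
    also have "l2_inner M (?A ?w) (T s (?A ?w)) = ?q (?A ?w)"
      using q[of "?A ?w"] w by (simp add: l2_inner_commute)
    finally have "?q ?w \<le> ?q (W (Suc n))" by simp
    with Suc show ?case by simp
  qed simp
  have growth: "2 * real n * ?q (W 0) \<le> (l2_norm M (W n))\<^sup>2" for n
  proof (induction n)
    case (Suc n)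
    have w: "W n \<in> L2 M" "T s (W n) \<in> L2 M" using W_L2 s by (auto simp: semigroup_L2)
    have "(l2_norm M (W (Suc n)))\<^sup>2 = (l2_norm M (\<lambda>x. W n x + T s (W n) x))\<^sup>2"
      using W_Suc[of n] w W_L2 by (subst l2_norm_cong_AE) (auto simp: L2_add)
    also have "\<dots> = (l2_norm M (W n))\<^sup>2 + 2 * ?q (W n) + (l2_norm M (T s (W n)))\<^sup>2"
      using w by (simp add: l2_norm_add_sq q l2_inner_commute)
    finally have "(l2_norm M (W n))\<^sup>2 + 2 * ?q (W n) \<le> (l2_norm M (W (Suc n)))\<^sup>2" by simp
    moreover have "2 * real (Suc n) * ?q (W 0) = 2 * real n * ?q (W 0) + 2 * ?q (W 0)"
      by (simp add: distrib_left distrib_right)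
    ultimately show ?case using Suc q_mono[of n] by linarith
  qed simp
  have "?q (W 0) \<le> 0"
  proof (rule ccontr)
    assume "\<not> ?thesis"
    then have "0 < ?q (W 0)" by linarith
    from reals_Archimedean3[OF this]
    obtain n where "(2 * l2_norm M u)\<^sup>2 < real n * ?q (W 0)" by blast
    moreover have "(l2_norm M (W n))\<^sup>2 \<le> (2 * l2_norm M u)\<^sup>2"
      using W_norm by (intro power_mono) auto
    moreover have "0 \<le> real n * ?q (W 0)" by simp
    ultimately show False
      using growth[of n] unfolding mult.assoc[of 2] by linarith
  qed
  then have "l2_norm M (T (s/2) (W 0)) = 0" by simp
  then have "AE x in M. T (s/2) (W 0) x = 0"
    using l2_norm_eq_0_iff[OF semigroup_L2, of "s/2" "W 0"] s W_L2 by simp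
  then have "AE x in M. W 0 x = 0"
    using semigroup_injective[of "s/2" "W 0"] s W_L2 by simp
  then show "AE x in M. T s (cut Y u) x = cut Y (T s u) x"
    by eventually_elim (simp add: W_def V_0 B_def)
qed

lemma semigroup_time_dist_le:
  assumes r: "r > 0" and h: "h > 0" and u: "u \<in> L2 M"
  shows "l2_norm M (\<lambda>x. T (r + h) u x - T r u x) \<le> l2_norm M (\<lambda>x. T h u x - u x)"
proof -
  have L2: "T h u \<in> L2 M" using semigroup_L2[OF h u] .
  have "l2_norm M (\<lambda>x. T (r + h) u x - T r u x) = l2_norm M (\<lambda>x. T r (T h u) x - T r u x)"
    using semigroup_add[OF r h u] r h u L2
    by (intro l2_norm_cong_AE) (auto simp: L2_diff semigroup_L2)
  also have "\<dots> \<le> l2_norm M (\<lambda>x. T h u x - u x)"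
    by (rule semigroup_dist_le[OF r L2 u])
  finally show ?thesis .
qed

lemma invariant_set_add:
  assumes s: "s > 0" and t: "t > 0" and "invariant_set M (T s) Y" "invariant_set M (T t) Y"
  shows "invariant_set M (T (s + t)) Y"
  unfolding invariant_set_iff_cut
proof (intro conjI ballI)
  show Y: "Y \<in> sets M" using assms by (simp add: invariant_set_def)
  fix u assume u: "u \<in> L2 M"
  have L2: "T t u \<in> L2 M" "T t (cut Y u) \<in> L2 M" "cut Y u \<in> L2 M" "cut Y (T t u) \<in> L2 M"
    using u t Y by (auto intro!: semigroup_L2 cut_L2)
  have "AE x in M. T (s + t) (cut Y u) x = T s (T t (cut Y u)) x"
       "AE x in M. T (s + t) u x = T s (T t u) x"
    using s t u L2 by (auto intro!: semigroup_add)
  moreover have "AE x in M. T s (T t (cut Y u)) x = T s (cut Y (T t u)) x"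
    using assms u L2 by (intro semigroup_cong_AE) (auto simp: invariant_set_iff_cut)
  moreover have "AE x in M. T s (cut Y (T t u)) x = cut Y (T s (T t u)) x"
    using assms L2 by (auto simp: invariant_set_iff_cut)
  ultimately show "AE x in M. T (s + t) (cut Y u) x = cut Y (T (s + t) u) x"
    by eventually_elim (simp add: cut_apply)
qed

text \<open>
  Invariance holds at the positive multiples of \<open>t / 2\<^sup>n\<close> for every \<open>n\<close>. Such a multiple \<open>r\<close> lies strictly
  below \<open>s\<close> and arbitrarily close to it, and \<open>T\<^sub>r\<close> is then strongly close to \<open>T\<^sub>s\<close>.
\<close>

lemma invariant_set_all_times:
  assumes t: "t > 0" and inv: "invariant_set M (T t) Y" and s: "s > 0"
  shows "invariant_set M (T s) Y"
proof -
  have Y: "Y \<in> sets M" using inv by (simp add: invariant_set_def)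
  have dyadic: "invariant_set M (T (t / 2^n)) Y" for n
  proof (induction n)
    case (Suc n)
    have "t / 2 ^ Suc n + t / 2 ^ Suc n = t / 2^n" by (simp add: field_simps)
    then show ?case
      using Suc t invariant_set_half[of "t / 2 ^ Suc n" Y] by simp
  qed (use inv in simp)
  have multiple: "invariant_set M (T (real (Suc k) * (t / 2^n))) Y" for k n
  proof (induction k)
    case (Suc k)
    have "real (Suc (Suc k)) * (t / 2^n) = real (Suc k) * (t / 2^n) + t / 2^n"
      unfolding of_nat_Suc[of "Suc k"] distrib_right by simp
    then show ?case
      using invariant_set_add[OF _ _ Suc dyadic[of n]] t by simp
  qed (use dyadic in simp)
  have "AE x in M. T s (cut Y u) x = cut Y (T s u) x" if u: "u \<in> L2 M" for u
  proof -
    let ?c = "cut Y u"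
    have c: "?c \<in> L2 M" using cut_L2[OF Y u] .
    define g where "g h = l2_norm M (\<lambda>x. T h ?c x - ?c x) + l2_norm M (\<lambda>x. T h u x - u x)" for h
    have L2: "T r u \<in> L2 M" "T r ?c \<in> L2 M" "cut Y (T r u) \<in> L2 M" if "r > 0" for r
      using that u c Y by (auto intro!: semigroup_L2 cut_L2)
    have small: "l2_norm M (\<lambda>x. T s ?c x - cut Y (T s u) x) \<le> e" if e: "e > 0" for e
    proof -
      have "(g \<longlongrightarrow> 0 + 0) (at_right 0)"
        using semigroup_strong_continuity[OF u] semigroup_strong_continuity[OF c]
        unfolding g_def l2_tendsto_def by (intro tendsto_add)
      then have "eventually (\<lambda>h. g h < e) (at_right 0)"
        using e by (intro order_tendstoD(2)) auto
      then obtain b where b: "b > 0" "\<And>h. 0 < h \<Longrightarrow> h < b \<Longrightarrow> g h < e"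
        unfolding eventually_at_right_field by auto
      define c where "c = min b s"
      have c_pos: "c > 0" "c \<le> b" "c \<le> s" using b s by (auto simp: c_def)
      obtain n where "t / c < 2 ^ n"
        using real_arch_pow[of 2 "t / c"] by auto
      then have "t / 2^n < c"
        using c_pos by (simp add: field_simps)
      then have n: "t / 2^n < b" "t / 2^n < s"
        using c_pos by linarith+
      \<comment> \<open>\<open>Suc k\<close> is the largest integer strictly below \<open>s / (t / 2^n)\<close>: both \<open>r\<close> and \<open>s - r\<close> have to be
        positive, because the operators \<open>T t\<close> are constrained for \<open>t > 0\<close> only\<close>
      define k where "k = nat \<lceil>s / (t / 2^n)\<rceil> - 2"
      define r where "r = real (Suc k) * (t / 2^n)"
      have "1 < s / (t / 2^n)" using n(2) t by (subst less_divide_eq_1_pos) auto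
      then have "real (nat \<lceil>s / (t / 2^n)\<rceil>) = of_int \<lceil>s / (t / 2^n)\<rceil>" "2 \<le> nat \<lceil>s / (t / 2^n)\<rceil>"
        by linarith+
      then have "real (Suc k) = of_int \<lceil>s / (t / 2^n)\<rceil> - 1"
        unfolding k_def by linarith
      then have "real (Suc k) < s / (t / 2^n)" "s / (t / 2^n) \<le> real (Suc k) + 1"
        by linarith+
      then have r: "r < s" "s \<le> r + t / 2^n"
        using t unfolding r_def by (auto simp: field_simps)
      have r_pos: "r > 0" using t unfolding r_def by (intro mult_pos_pos) auto
      define h where "h = s - r"
      have h: "h > 0" "h < b" "s = r + h" using r n by (auto simp: h_def)
      have "l2_norm M (\<lambda>x. T s ?c x - cut Y (T s u) x)
          \<le> l2_norm M (\<lambda>x. T s ?c x - T r ?c x) + l2_norm M (\<lambda>x. T r ?c x - cut Y (T s u) x)"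
        using s r_pos by (intro l2_norm_triangle_diff L2) auto
      also have "l2_norm M (\<lambda>x. T r ?c x - cut Y (T s u) x)
          = l2_norm M (cut Y (\<lambda>x. T r u x - T s u x))"
      proof (rule l2_norm_cong_AE)
        have "AE x in M. T r ?c x = cut Y (T r u) x"
          using multiple[of k n] u by (simp add: r_def invariant_set_iff_cut)
        then show "AE x in M. T r ?c x - cut Y (T s u) x = cut Y (\<lambda>x. T r u x - T s u x) x"
          by eventually_elim (simp add: cut_diff)
      qed (use s r_pos in \<open>auto intro!: L2_diff L2 cut_L2 Y\<close>)
      also have "\<dots> \<le> l2_norm M (\<lambda>x. T r u x - T s u x)"
        using s r_pos by (intro l2_norm_cut_le Y L2_diff L2) auto
      also have "\<dots> = l2_norm M (\<lambda>x. T s u x - T r u x)"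
        by (rule l2_norm_commute)
      also have "l2_norm M (\<lambda>x. T s ?c x - T r ?c x) + \<dots> \<le> g h"
        unfolding g_def h(3) using r_pos h u c by (intro add_mono semigroup_time_dist_le)
      also have "\<dots> < e" using b h by simp
      finally show ?thesis by simp
    qed
    have "l2_norm M (\<lambda>x. T s ?c x - cut Y (T s u) x) \<le> 0"
      by (rule field_le_epsilon) (use small in simp)
    then show ?thesis
      using l2_dist_eq_0_iff[OF L2(2)[OF s] L2(3)[OF s]] l2_norm_nonneg[of M "\<lambda>x. T s ?c x - cut Y (T s u) x"]
      by auto
  qed
  then show ?thesis using Y by (simp add: invariant_set_iff_cut)
qed

end

section \<open>The operator of a closed form\<close>

text \<open>
  Stated with the midpoint, this shows that near-minimizers of a quadratic functional are close
  to each other.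
\<close>

lemma form_parallelogram:
  assumes "nonneg_quadratic_form M E" "u \<in> form_dom E" "v \<in> form_dom E"
  shows "form_val E (\<lambda>x. u x - v x) =
    2 * form_val E u + 2 * form_val E v - 4 * form_val E (\<lambda>x. 1/2 * (u x + v x))"
proof -
  have "form_val E (\<lambda>x. 1/2 * (u x + v x)) = (1/2)\<^sup>2 * form_val E (\<lambda>x. u x + v x)"
    by (rule form_val_scale[OF assms(1) form_dom_add[OF assms]])
  then show ?thesis
    by (simp add: form_val_add[OF assms] form_val_diff[OF assms] power2_eq_square)
qed

lemma Cauchy_of_inverse_Suc_bound:
  fixes q :: "nat \<Rightarrow> nat \<Rightarrow> real"
  assumes "\<And>n k. q n k \<le> 2 / real (Suc n) + 2 / real (Suc k)" and e: "e > 0"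
  shows "\<exists>N. \<forall>n\<ge>N. \<forall>k\<ge>N. q n k < e"
proof -
  obtain N :: nat where N: "real N > 4 / e" using reals_Archimedean2 by blast
  have "q n k < e" if "n \<ge> N" "k \<ge> N" for n k
  proof -
    have *: "2 / real (Suc j) < e / 2" if "j \<ge> N" for j
    proof -
      have "4 / e < real (Suc j)" using N that by linarith
      then show ?thesis using e by (simp add: field_simps)
    qed
    show ?thesis using assms(1)[of n k] *[OF that(1)] *[OF that(2)] by linarith
  qed
  then show ?thesis by blast
qed

text \<open>
  The first-order condition at a minimum: a quadratic polynomial without constant term that is nowhere
  negative has no linear term. The value of \<open>s\<close> in the proof stays meaningful for \<open>d = 0\<close>.
\<close>

lemma linear_coefficient_zero:
  fixes c d :: real
  assumes d: "0 \<le> d" and quad: "\<And>s. 0 \<le> 2 * s * c + s\<^sup>2 * d"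
  shows "c = 0"
proof (rule ccontr)
  assume c: "c \<noteq> 0"
  define k where "k = d + 1"
  define s where "s = - c / k"
  have sk: "s * k = - c" using d by (simp add: s_def k_def)
  have "k\<^sup>2 * (2 * s * c + s\<^sup>2 * d) = 2 * (s * k) * c * k + (s * k)\<^sup>2 * d"
    by (simp add: power2_eq_square algebra_simps)
  also have "\<dots> = - (c\<^sup>2 * (d + 2))"
    unfolding sk by (simp add: k_def power2_eq_square algebra_simps)
  also have "\<dots> < 0" using c d by simp
  finally show False using mult_nonneg_nonneg[OF zero_le_power2 quad, of k s] by linarith
qed

text \<open>
  The solution \<open>w\<close> of \<open>L w = \<alpha> (u - w)\<close>, that is \<open>w = \<alpha> (\<alpha> + L)\<^sup>-\<^sup>1 u\<close>, is the minimizer of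
  \<open>J w = E[w] + \<alpha> \<parallel>w - u\<parallel>\<^sup>2\<close>. By the parallelogram identity a minimizing sequence is Cauchy both in
  \<open>L\<^sup>2\<close> and for the form, and closedness supplies its limit. The equation is the first-order
  condition, obtained from near-minimality of the sequence by passing to the limit in each
  direction \<open>v\<close>.
\<close>

lemma resolvent_exists:
  assumes E: "nonneg_quadratic_form M E" and closed: "closed_form M E"
    and u: "u \<in> L2 M" and \<alpha>: "\<alpha> > 0"
  shows "\<exists>w. form_operator M E w (\<lambda>x. \<alpha> * (u x - w x))"
proof -
  let ?D = "form_dom E"
  note L2 = form_dom_L2[OF E] and dom = form_dom_closed[OF E]
  define J where "J w = form_val E w + \<alpha> * (l2_norm M (\<lambda>x. w x - u x))\<^sup>2" for w
  define m where "m = Inf (J ` ?D)"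
  have J_nonneg: "0 \<le> J w" if "w \<in> ?D" for w
    using form_val_nonneg[OF E that] \<alpha> by (simp add: J_def)
  have bdd: "bdd_below (J ` ?D)" using J_nonneg by (auto intro!: bdd_belowI[of _ 0])
  have m_le: "m \<le> J w" if "w \<in> ?D" for w
    unfolding m_def using bdd that by (auto intro: cInf_lower)
  have "\<exists>w\<in>?D. J w < m + 1 / real (Suc n)" for n
  proof -
    have "J ` ?D \<noteq> {}" using form_dom_zero[OF E] by auto
    then have "\<exists>y\<in>J ` ?D. y < m + 1 / real (Suc n)"
      unfolding m_def by (intro cInf_lessD) auto
    then show ?thesis by auto
  qed
  then obtain W where W: "\<And>n. W n \<in> ?D" and JW: "\<And>n. J (W n) < m + 1 / real (Suc n)"
    by metis
  have W_L2: "W n \<in> L2 M" for n using L2[OF W] .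
  have gap: "form_val E (\<lambda>x. W n x - W k x) + \<alpha> * (l2_norm M (\<lambda>x. W n x - W k x))\<^sup>2
      \<le> 2 / real (Suc n) + 2 / real (Suc k)" for n k
  proof -
    let ?h = "\<lambda>x. 1/2 * (W n x + W k x)"
    have h: "?h \<in> ?D" using W by (intro dom)
    have e1: "form_val E (\<lambda>x. W n x - W k x)
        = 2 * form_val E (W n) + 2 * form_val E (W k) - 4 * form_val E ?h"
      by (rule form_parallelogram[OF E W W])
    have e2: "(l2_norm M (\<lambda>x. W n x - W k x))\<^sup>2
        = 2 * (l2_norm M (\<lambda>x. W n x - u x))\<^sup>2 + 2 * (l2_norm M (\<lambda>x. W k x - u x))\<^sup>2
          - 4 * (l2_norm M (\<lambda>x. ?h x - u x))\<^sup>2"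
    proof -
      have a: "(\<lambda>x. W n x - u x) \<in> L2 M" "(\<lambda>x. W k x - u x) \<in> L2 M" "(\<lambda>x. ?h x - u x) \<in> L2 M"
          "(\<lambda>x. W n x - W k x) \<in> L2 M"
        using W_L2 u L2[OF h] by (auto intro!: L2_diff)
      have b: "(\<lambda>x. 1/2 * ((W n x - u x) + (W k x - u x))) = (\<lambda>x. ?h x - u x)"
          "(\<lambda>x. (W n x - u x) - (W k x - u x)) = (\<lambda>x. W n x - W k x)"
        by (auto simp: fun_eq_iff field_simps)
      show ?thesis
        using form_parallelogram[OF nonneg_quadratic_form_l2, simplified l2_form_simps, OF a(1,2)]
        unfolding b by (simp only: form_val_l2[OF a(1)] form_val_l2[OF a(2)] form_val_l2[OF a(3)]
            form_val_l2[OF a(4)])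
    qed
    have "form_val E (\<lambda>x. W n x - W k x) + \<alpha> * (l2_norm M (\<lambda>x. W n x - W k x))\<^sup>2
        = 2 * J (W n) + 2 * J (W k) - 4 * J ?h"
      unfolding J_def e1 e2 by (simp add: algebra_simps)
    moreover have "2 / real (Suc n) = 2 * (1 / real (Suc n))" "2 / real (Suc k) = 2 * (1 / real (Suc k))"
      by simp_all
    ultimately show ?thesis using JW[of n] JW[of k] m_le[OF h] by linarith
  qed
  have "\<exists>N. \<forall>n\<ge>N. \<forall>k\<ge>N. form_val E (\<lambda>x. W n x - W k x) < e" if "e > 0" for e
  proof (rule Cauchy_of_inverse_Suc_bound[OF _ that])
    fix n k
    have "0 \<le> \<alpha> * (l2_norm M (\<lambda>x. W n x - W k x))\<^sup>2" using \<alpha> by simp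
    then show "form_val E (\<lambda>x. W n x - W k x) \<le> 2 / real (Suc n) + 2 / real (Suc k)"
      using gap[of n k] by linarith
  qed
  note E_Cauchy = this
  have "\<exists>N. \<forall>n\<ge>N. \<forall>k\<ge>N. l2_norm M (\<lambda>x. W n x - W k x) < e" if "e > 0" for e
  proof -
    have "\<exists>N. \<forall>n\<ge>N. \<forall>k\<ge>N. \<alpha> * (l2_norm M (\<lambda>x. W n x - W k x))\<^sup>2 < \<alpha> * e\<^sup>2"
    proof (rule Cauchy_of_inverse_Suc_bound)
      fix n k
      have "0 \<le> form_val E (\<lambda>x. W n x - W k x)" using W by (intro form_val_nonneg[OF E] dom)
      then show "\<alpha> * (l2_norm M (\<lambda>x. W n x - W k x))\<^sup>2 \<le> 2 / real (Suc n) + 2 / real (Suc k)"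
        using gap[of n k] by linarith
    qed (use \<alpha> that in simp)
    then obtain N where "\<And>n k. n \<ge> N \<Longrightarrow> k \<ge> N \<Longrightarrow> (l2_norm M (\<lambda>x. W n x - W k x))\<^sup>2 < e\<^sup>2"
      using \<alpha> by auto
    then show ?thesis using that by (intro exI[of _ N]) (auto intro: power2_less_imp_less)
  qed
  then obtain w where w_L2: "w \<in> L2 M" and w_lim: "l2_tendsto M W w sequentially"
    using L2_complete[of W M] W_L2 by blast
  have w: "w \<in> ?D" and Ew: "(\<lambda>n. form_val E (\<lambda>x. W n x - w x)) \<longlonglongrightarrow> 0"
    using closed[unfolded closed_form_def] W w_L2 w_lim E_Cauchy by blast+
  have "form_bil E w v = l2_inner M (\<lambda>x. \<alpha> * (u x - w x)) v" if v: "v \<in> ?D" for v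
  proof -
    have v_L2: "v \<in> L2 M" using L2[OF v] .
    \<comment> \<open>as a function of \<open>s\<close>, \<open>J (w + s v) = J w + 2 s c + s\<^sup>2 d\<close>, with \<open>c\<close> depending on \<open>w\<close>\<close>
    let ?c = "\<lambda>w. form_bil E w v + \<alpha> * (l2_inner M w v - l2_inner M u v)"
    let ?d = "form_val E v + \<alpha> * (l2_norm M v)\<^sup>2"
    have d: "0 \<le> ?d" using form_val_nonneg[OF E v] \<alpha> by simp
    have c_lim: "(\<lambda>n. ?c (W n)) \<longlonglongrightarrow> ?c w"
      using l2_tendsto_imp_weak[OF W_L2 w_L2 w_lim] v_L2
      by (intro tendsto_intros form_bil_tendsto[OF E W w v Ew]) (auto simp: l2_weak_tendsto_def)
    have step: "0 \<le> 1 / real (Suc n) + (2 * s * ?c (W n) + s\<^sup>2 * ?d)" for n s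
    proof -
      have "J (\<lambda>x. W n x + s * v x) = J (W n) + 2 * s * ?c (W n) + s\<^sup>2 * ?d"
      proof -
        have e1: "form_val E (\<lambda>x. W n x + s * v x)
            = form_val E (W n) + 2 * s * form_bil E (W n) v + s\<^sup>2 * form_val E v"
          using W v by (simp add: form_val_add[OF E] dom form_bil_scale_right[OF E]
              form_val_scale[OF E])
        have e2: "(l2_norm M (\<lambda>x. W n x + s * v x - u x))\<^sup>2
            = (l2_norm M (\<lambda>x. W n x - u x))\<^sup>2 + 2 * s * (l2_inner M (W n) v - l2_inner M u v)
              + s\<^sup>2 * (l2_norm M v)\<^sup>2"
        proof -
          have "(\<lambda>x. W n x + s * v x - u x) = (\<lambda>x. (W n x - u x) + s * v x)"
            by (simp add: fun_eq_iff)
          then have "(l2_norm M (\<lambda>x. W n x + s * v x - u x))\<^sup>2 = (l2_norm M (\<lambda>x. W n x - u x))\<^sup>2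
              + 2 * l2_inner M (\<lambda>x. W n x - u x) (\<lambda>x. s * v x) + (l2_norm M (\<lambda>x. s * v x))\<^sup>2"
            using l2_norm_add_sq[OF L2_diff[OF W_L2 u] L2_scale[OF v_L2], of n s] by simp
          then show ?thesis
            using W_L2[of n] u v_L2
            by (simp add: l2_inner_bilinear L2_diff L2_scale l2_norm_scale power_mult_distrib
                right_diff_distrib mult.assoc)
        qed
        show ?thesis unfolding J_def e1 e2 by (simp add: algebra_simps)
      qed
      moreover have "m \<le> J (\<lambda>x. W n x + s * v x)" using W v by (intro m_le dom)
      ultimately show ?thesis using JW[of n] by linarith
    qed
    have quad: "0 \<le> 2 * s * ?c w + s\<^sup>2 * ?d" for s
    proof (rule LIMSEQ_le_const)
      have "(\<lambda>n. 1 / real (Suc n) + (2 * s * ?c (W n) + s\<^sup>2 * ?d)) \<longlonglongrightarrow> 0 + (2 * s * ?c w + s\<^sup>2 * ?d)"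
        using LIMSEQ_Suc[OF lim_1_over_n] by (intro tendsto_intros c_lim)
      then show "(\<lambda>n. 1 / real (Suc n) + (2 * s * ?c (W n) + s\<^sup>2 * ?d)) \<longlonglongrightarrow> 2 * s * ?c w + s\<^sup>2 * ?d"
        by simp
    qed (use step in blast)
    have "?c w = 0" by (rule linear_coefficient_zero[OF d quad])
    then show ?thesis
      using u w_L2 v_L2 by (simp add: l2_inner_bilinear L2_diff L2_scale algebra_simps)
  qed
  then show ?thesis
    using w w_L2 u by (intro exI[of _ w]) (auto simp: form_operator_def L2_diff L2_scale)
qed

lemma form_operator_diff:
  assumes E: "nonneg_quadratic_form M E"
    and u: "form_operator M E u f" and v: "form_operator M E v g"
  shows "form_operator M E (\<lambda>x. u x - v x) (\<lambda>x. f x - g x)"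
  using u v unfolding form_operator_def
  by (auto simp: form_dom_diff[OF E] L2_diff form_bil_diff_left[OF E] l2_inner_bilinear form_dom_L2[OF E])

text \<open>
  The approximants are \<open>W\<^sub>n = \<alpha>\<^sub>n (\<alpha>\<^sub>n + L)\<^sup>-\<^sup>1 u\<close> with \<open>\<alpha>\<^sub>n = n + 1\<close>. Put \<open>a\<^sub>n = u - W\<^sub>n\<close>, so that
  \<open>E(W\<^sub>n, v) = \<alpha>\<^sub>n \<langle>a\<^sub>n, v\<rangle>\<close>. Expanding \<open>E[W\<^sub>n + a\<^sub>n] = E[u]\<close> gives
  \<open>E[W\<^sub>n] + 2 \<alpha>\<^sub>n \<parallel>a\<^sub>n\<parallel>\<^sup>2 \<le> E[u]\<close>, hence \<open>W\<^sub>n \<rightarrow> u\<close> in \<open>L\<^sup>2\<close> and \<open>E[W\<^sub>n] \<le> E[u]\<close>. For \<open>n \<le> k\<close> one has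
  \<open>\<parallel>a\<^sub>k\<parallel> \<le> \<parallel>a\<^sub>n\<parallel>\<close>, so \<open>E(W\<^sub>n, W\<^sub>k - W\<^sub>n) = \<alpha>\<^sub>n \<langle>a\<^sub>n, a\<^sub>n - a\<^sub>k\<rangle> \<ge> 0\<close> and therefore
  \<open>E[W\<^sub>k - W\<^sub>n] \<le> E[W\<^sub>k] - E[W\<^sub>n]\<close>: the bounded sequence \<open>E[W\<^sub>n]\<close> is nondecreasing, and its being
  Cauchy makes \<open>W\<^sub>n\<close> Cauchy for the form.
\<close>

lemma form_operator_core:
  assumes E: "nonneg_quadratic_form M E" and closed: "closed_form M E" and u: "u \<in> form_dom E"
  obtains W F where "\<And>n. form_operator M E (W n) (F n)" "l2_tendsto M W u sequentially"
    "\<And>e. e > 0 \<Longrightarrow> \<exists>N. \<forall>m\<ge>N. \<forall>n\<ge>N. form_val E (\<lambda>x. W m x - W n x) < e"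
proof -
  let ?D = "form_dom E"
  note L2 = form_dom_L2[OF E] and dom = form_dom_closed[OF E]
  have u_L2: "u \<in> L2 M" using L2[OF u] .
  have "\<forall>n. \<exists>w. form_operator M E w (\<lambda>x. real (Suc n) * (u x - w x))"
    using resolvent_exists[OF E closed u_L2] by simp
  then obtain W where W: "\<And>n. form_operator M E (W n) (\<lambda>x. real (Suc n) * (u x - W n x))"
    by metis
  have W_dom: "W n \<in> ?D" for n using W by (simp add: form_operator_def)
  define a where "a n = (\<lambda>x. u x - W n x)" for n
  have a_dom: "a n \<in> ?D" for n unfolding a_def using u W_dom by (intro dom)
  have a_L2: "a n \<in> L2 M" for n using L2[OF a_dom] .
  have bil_W: "form_bil E (W n) v = real (Suc n) * l2_inner M (a n) v" if "v \<in> ?D" for n v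
    using W[of n] that a_L2 L2 unfolding form_operator_def a_def
    by (simp add: l2_inner_bilinear)
  have val_u: "form_val E (W n) + 2 * (real (Suc n) * (l2_norm M (a n))\<^sup>2) \<le> form_val E u" for n
  proof -
    have "form_val E (\<lambda>x. W n x + a n x) = form_val E (W n) + 2 * form_bil E (W n) (a n) + form_val E (a n)"
      by (rule form_val_add[OF E W_dom a_dom])
    moreover have "(\<lambda>x. W n x + a n x) = u" by (simp add: a_def)
    ultimately show ?thesis
      using bil_W[OF a_dom[of n], of n] form_val_nonneg[OF E a_dom[of n]] a_L2[of n]
      by (simp add: l2_inner_self)
  qed
  have W_lim: "l2_tendsto M W u sequentially"
    unfolding l2_tendsto_def
  proof (rule Lim_null_comparison)
    let ?b = "\<lambda>n. sqrt (form_val E u * (1 / real (Suc n)))"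
    show "\<forall>\<^sub>F n in sequentially. norm (l2_norm M (\<lambda>x. W n x - u x)) \<le> ?b n"
    proof (rule always_eventually, rule allI)
      fix n
      have "real (Suc n) * (l2_norm M (a n))\<^sup>2 \<le> form_val E u"
        using val_u[of n] form_val_nonneg[OF E W_dom[of n]]
          mult_nonneg_nonneg[OF of_nat_0_le_iff zero_le_power2, of "Suc n" "l2_norm M (a n)"] by linarith
      then have "(l2_norm M (a n))\<^sup>2 \<le> form_val E u * (1 / real (Suc n))"
        by (simp add: field_simps)
      then have "l2_norm M (a n) \<le> ?b n" by (rule real_le_rsqrt)
      then show "norm (l2_norm M (\<lambda>x. W n x - u x)) \<le> ?b n"
        by (simp add: a_def l2_norm_commute[of M u])
    qed
    have "?b \<longlonglongrightarrow> sqrt (form_val E u * 0)"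
      using LIMSEQ_Suc[OF lim_1_over_n] by (intro tendsto_intros)
    then show "?b \<longlonglongrightarrow> 0" by simp
  qed
  have step: "form_val E (\<lambda>x. W k x - W n x) \<le> form_val E (W k) - form_val E (W n)" if nk: "n \<le> k" for n k
  proof -
    let ?A = "l2_norm M (a n)" and ?B = "l2_norm M (a k)"
    let ?w = "\<lambda>x. a n x - a k x"
    have w: "?w = (\<lambda>x. W k x - W n x)" by (simp add: a_def fun_eq_iff)
    have w_dom: "?w \<in> ?D" using a_dom by (intro dom)
    have CS: "l2_inner M (a n) (a k) \<le> ?A * ?B"
      using l2_Cauchy_Schwarz[OF a_L2 a_L2, of n k] by linarith
    \<comment> \<open>otherwise \<open>E[W k - W n]\<close>, computed through the equations for \<open>W k\<close> and \<open>W n\<close>, would be negative\<close>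
    have "?B \<le> ?A"
    proof (rule ccontr)
      assume less: "\<not> ?B \<le> ?A"
      have "0 \<le> form_bil E ?w ?w"
        using form_val_nonneg[OF E w_dom] by (simp add: form_val_def)
      also have "form_bil E ?w ?w = form_bil E (W k) ?w - form_bil E (W n) ?w"
        using W_dom w_dom unfolding w by (simp add: form_bil_diff_left[OF E])
      also have "\<dots> = (real (Suc k) + real (Suc n)) * l2_inner M (a n) (a k)
          - real (Suc k) * ?B\<^sup>2 - real (Suc n) * ?A\<^sup>2"
        using w_dom a_L2
        by (simp add: bil_W l2_inner_bilinear l2_inner_commute[of "a k" M "a n"] l2_inner_self algebra_simps)
      also have "\<dots> \<le> (real (Suc k) + real (Suc n)) * (?A * ?B)
          - real (Suc k) * ?B\<^sup>2 - real (Suc n) * ?A\<^sup>2"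
        using CS by (intro diff_right_mono mult_left_mono) auto
      also have "\<dots> = (?B - ?A) * (real (Suc n) * ?A - real (Suc k) * ?B)"
        by (simp add: power2_eq_square algebra_simps)
      also have "\<dots> < 0"
      proof (rule mult_pos_neg)
        have "real (Suc n) * ?A \<le> real (Suc k) * ?A" using nk by (intro mult_right_mono) auto
        also have "\<dots> < real (Suc k) * ?B" using less by simp
        finally show "real (Suc n) * ?A - real (Suc k) * ?B < 0" by simp
      qed (use less in simp)
      finally show False by simp
    qed
    then have "?A * ?B \<le> ?A * ?A" by (intro mult_left_mono) auto
    with CS have "l2_inner M (a n) (a k) \<le> ?A\<^sup>2" by (simp add: power2_eq_square)
    then have "0 \<le> real (Suc n) * (?A\<^sup>2 - l2_inner M (a n) (a k))"
      by (intro mult_nonneg_nonneg) auto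
    also have "\<dots> = form_bil E (W n) ?w"
      using w_dom a_L2 by (simp add: bil_W l2_inner_bilinear l2_inner_self)
    finally have "0 \<le> form_bil E (W n) (\<lambda>x. W k x - W n x)" by (simp add: w)
    then have "form_val E (W n) \<le> form_bil E (W k) (W n)"
      using W_dom by (simp add: form_bil_diff_right[OF E] form_val_def form_bil_commute[OF E, of "W k"])
    then show ?thesis
      using form_val_diff[OF E W_dom W_dom, of k n] by linarith
  qed
  have Cauchy: "\<exists>N. \<forall>m\<ge>N. \<forall>n\<ge>N. form_val E (\<lambda>x. W m x - W n x) < e" if e: "e > 0" for e
  proof -
    have "incseq (\<lambda>n. form_val E (W n))"
    proof (rule incseq_SucI)
      fix n
      show "form_val E (W n) \<le> form_val E (W (Suc n))"
        using step[of n "Suc n"] form_val_nonneg[OF E form_dom_diff[OF E W_dom W_dom], of "Suc n" n]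
        by simp
    qed
    moreover have "form_val E (W n) \<le> form_val E u" for n
    proof -
      have "0 \<le> 2 * (real (Suc n) * (l2_norm M (a n))\<^sup>2)" by simp
      then show ?thesis using val_u[of n] by linarith
    qed
    ultimately have "convergent (\<lambda>n. form_val E (W n))"
      by (metis incseq_convergent convergentI)
    then have "Cauchy (\<lambda>n. form_val E (W n))" by (rule convergent_Cauchy)
    then obtain N where N: "\<And>m n. m \<ge> N \<Longrightarrow> n \<ge> N \<Longrightarrow> \<bar>form_val E (W m) - form_val E (W n)\<bar> < e"
      using e unfolding Cauchy_def dist_real_def by blast
    have "form_val E (\<lambda>x. W m x - W n x) < e" if "m \<ge> N" "n \<ge> N" for m n
    proof (cases "n \<le> m")
      case True
      then show ?thesis using step[OF True] N[OF that] by linarith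
    next
      case False
      have "form_val E (\<lambda>x. W m x - W n x) = form_val E (\<lambda>x. W n x - W m x)"
        by (simp add: form_val_diff[OF E W_dom W_dom] form_bil_commute[OF E W_dom W_dom, of m n])
      then show ?thesis using step[of m n] False N[OF that] by linarith
    qed
    then show ?thesis by blast
  qed
  show ?thesis by (rule that[OF W W_lim Cauchy])
qed

lemma form_operator_domain_dense:
  assumes E: "nonneg_quadratic_form M E" and closed: "closed_form M E" and dense: "densely_defined M E"
    and u: "u \<in> L2 M" and e: "e > 0"
  obtains w f where "form_operator M E w f" "l2_norm M (\<lambda>x. u x - w x) < e"
proof -
  obtain v where v: "v \<in> form_dom E" "l2_norm M (\<lambda>x. u x - v x) < e/2"
    using dense u e unfolding densely_defined_def by (meson half_gt_zero)
  obtain W F where W: "\<And>n. form_operator M E (W n) (F n)" and lim: "l2_tendsto M W v sequentially"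
    using form_operator_core[OF E closed v(1)] by metis
  have W_L2: "W n \<in> L2 M" for n
    using W form_dom_L2[OF E] by (auto simp: form_operator_def)
  have "\<forall>\<^sub>F n in sequentially. l2_norm M (\<lambda>x. W n x - v x) < e/2"
    using lim e unfolding l2_tendsto_def by (intro order_tendstoD) auto
  then obtain n where "l2_norm M (\<lambda>x. W n x - v x) < e/2"
    by (auto simp: eventually_sequentially)
  then have "l2_norm M (\<lambda>x. u x - W n x) < e"
    using l2_norm_triangle_diff[OF u form_dom_L2[OF E v(1)] W_L2[of n]] v(2)
      l2_norm_commute[of M v "W n"] by linarith
  then show ?thesis using that W by blast
qed

section \<open>Invariance of the semigroup, of the operator and of the form\<close>

definition operator_invariant :: "'a measure \<Rightarrow> 'a qform \<Rightarrow> 'a set \<Rightarrow> bool" where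
  "operator_invariant M E Y \<longleftrightarrow>
     (\<forall>u f. form_operator M E u f \<longrightarrow> form_operator M E (cut Y u) (cut Y f))"

text \<open>
  The polarized form of the splitting \<open>E[u] = E[P u] + E[u - P u]\<close>; unlike the latter it can be used
  for two different arguments.
\<close>

definition form_invariant :: "'a qform \<Rightarrow> 'a set \<Rightarrow> bool" where
  "form_invariant E Y \<longleftrightarrow>
     (\<forall>u\<in>form_dom E. cut Y u \<in> form_dom E) \<and>
     (\<forall>u\<in>form_dom E. \<forall>v\<in>form_dom E. form_bil E (cut Y u) (\<lambda>x. v x - cut Y v x) = 0)"

lemma generator_cut:
  assumes inv: "\<And>s. s > 0 \<Longrightarrow> invariant_set M (T s) Y" and sg: "contraction_semigroup M T"
    and gen: "semigroup_generator M T u f"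
  shows "semigroup_generator M T (cut Y u) (cut Y f)"
proof -
  have Y: "Y \<in> sets M" using inv[of 1] by (simp add: invariant_set_def)
  have u: "u \<in> L2 M" and f: "f \<in> L2 M" and lim: "l2_tendsto M (\<lambda>t x. (T t u x - u x) / t) f (at_right 0)"
    using gen by (auto simp: semigroup_generator_def)
  let ?d = "\<lambda>t x. (T t (cut Y u) x - cut Y u x) / t - cut Y f x"
  let ?e = "\<lambda>t x. (T t u x - u x) / t - f x"
  have le: "norm (l2_norm M (?d t)) \<le> l2_norm M (?e t)" if t: "t > 0" for t
  proof -
    have L2: "T t u \<in> L2 M" "T t (cut Y u) \<in> L2 M" "cut Y u \<in> L2 M" "cut Y f \<in> L2 M"
      using t u f Y by (auto intro!: semigroup_L2[OF sg] cut_L2)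
    have e: "?e t \<in> L2 M"
      using L2_diff[OF L2_scale[OF L2_diff[OF L2(1) u], of "1/t"] f] by simp
    have d: "?d t \<in> L2 M"
      using L2_diff[OF L2_scale[OF L2_diff[OF L2(2,3)], of "1/t"] L2(4)] by simp
    have "l2_norm M (?d t) = l2_norm M (cut Y (?e t))"
    proof (rule l2_norm_cong_AE[OF d cut_L2[OF Y e]])
      have "AE x in M. T t (cut Y u) x = cut Y (T t u) x"
        using inv[OF t] u by (simp add: invariant_set_iff_cut)
      then show "AE x in M. ?d t x = cut Y (?e t) x"
        by eventually_elim (simp add: cut_apply algebra_simps)
    qed
    then show ?thesis using l2_norm_cut_le[OF Y e] by simp
  qed
  have "l2_tendsto M (\<lambda>t x. (T t (cut Y u) x - cut Y u x) / t) (cut Y f) (at_right 0)"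
    unfolding l2_tendsto_def
  proof (rule Lim_null_comparison)
    show "\<forall>\<^sub>F t in at_right 0. norm (l2_norm M (?d t)) \<le> l2_norm M (?e t)"
      using le by (auto simp: eventually_at_right_field intro: exI[of _ 1])
    show "((\<lambda>t. l2_norm M (?e t)) \<longlongrightarrow> 0) (at_right 0)"
      using lim by (simp add: l2_tendsto_def)
  qed
  then show ?thesis using u f Y by (simp add: semigroup_generator_def cut_L2)
qed

lemma semigroup_invariant_imp_operator_invariant:
  assumes sg: "form_semigroup M E T" and inv: "\<And>s. s > 0 \<Longrightarrow> invariant_set M (T s) Y"
  shows "operator_invariant M E Y"
  unfolding operator_invariant_def
proof (intro allI impI)
  fix u f assume "form_operator M E u f"
  then have "semigroup_generator M T u (\<lambda>x. - f x)"
    using sg by (simp add: form_semigroup_def)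
  then have "semigroup_generator M T (cut Y u) (cut Y (\<lambda>x. - f x))"
    using generator_cut[of M T Y u "\<lambda>x. - f x", OF inv] sg by (auto simp: form_semigroup_def)
  then show "form_operator M E (cut Y u) (cut Y f)"
    using sg by (simp add: form_semigroup_def cut_def)
qed

text \<open>
  For \<open>w\<close> in the domain of \<open>L\<close>, \<open>E(P w, v - P v) = \<langle>P L w, v - P v\<rangle> = 0\<close>; in particular
  \<open>E[P w] \<le> E[w]\<close>. So \<open>P\<close> maps a sequence in the domain of \<open>L\<close> that approximates \<open>u\<close> in \<open>L\<^sup>2\<close> and is
  Cauchy for the form to one with the same properties for \<open>P u\<close>, and closedness carries the
  orthogonality over to \<open>u\<close>.
\<close>

lemma operator_invariant_imp_form_invariant:
  assumes E: "nonneg_quadratic_form M E" and closed: "closed_form M E" and Y: "Y \<in> sets M"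
    and inv: "operator_invariant M E Y"
  shows "form_invariant E Y"
proof -
  let ?D = "form_dom E"
  note L2 = form_dom_L2[OF E] and dom = form_dom_closed[OF E]
  have orth: "form_bil E (cut Y w) (\<lambda>x. v x - cut Y v x) = 0"
    if w: "form_operator M E w f" and v: "v \<in> ?D" "cut Y v \<in> ?D" for w f v
  proof -
    have "form_operator M E (cut Y w) (cut Y f)" using inv w by (simp add: operator_invariant_def)
    then have "form_bil E (cut Y w) (\<lambda>x. v x - cut Y v x) = l2_inner M (cut Y f) (\<lambda>x. v x - cut Y v x)"
      using v dom unfolding form_operator_def by blast
    also have "\<dots> = 0" by (simp add: l2_inner_cut cut_diff) (simp add: l2_inner_def)
    finally show ?thesis .
  qed
  have contr: "form_val E (cut Y w) \<le> form_val E w" if w: "form_operator M E w f" for w f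
  proof -
    have d: "w \<in> ?D" "cut Y w \<in> ?D"
      using w inv by (auto simp: operator_invariant_def form_operator_def)
    have "form_val E (\<lambda>x. cut Y w x + (w x - cut Y w x)) =
        form_val E (cut Y w) + 2 * form_bil E (cut Y w) (\<lambda>x. w x - cut Y w x)
        + form_val E (\<lambda>x. w x - cut Y w x)"
      using d by (intro form_val_add[OF E] dom)
    then show ?thesis
      using orth[OF w d] form_val_nonneg[OF E form_dom_diff[OF E d]] by simp
  qed
  have approx: "cut Y u \<in> ?D \<and> (\<exists>W F. (\<forall>n. form_operator M E (W n) (F n)) \<and>
      (\<lambda>n. form_val E (\<lambda>x. cut Y (W n) x - cut Y u x)) \<longlonglongrightarrow> 0)" if u: "u \<in> ?D" for u
  proof -
    obtain W F where W: "\<And>n. form_operator M E (W n) (F n)" and lim: "l2_tendsto M W u sequentially"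
      and Cauchy: "\<And>e. e > 0 \<Longrightarrow> \<exists>N. \<forall>m\<ge>N. \<forall>n\<ge>N. form_val E (\<lambda>x. W m x - W n x) < e"
      using form_operator_core[OF E closed u] by metis
    have d: "W n \<in> ?D" "cut Y (W n) \<in> ?D" for n
      using W[of n] inv by (auto simp: operator_invariant_def form_operator_def)
    have "\<exists>N. \<forall>m\<ge>N. \<forall>n\<ge>N. form_val E (\<lambda>x. cut Y (W m) x - cut Y (W n) x) < e" if "e > 0" for e
    proof -
      have "form_val E (\<lambda>x. cut Y (W m) x - cut Y (W n) x) \<le> form_val E (\<lambda>x. W m x - W n x)" for m n
        using contr[OF form_operator_diff[OF E W W]] by (simp add: cut_diff)
      then show ?thesis using Cauchy[OF that] by (meson order_le_less_trans)
    qed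
    moreover have "l2_tendsto M (\<lambda>n. cut Y (W n)) (cut Y u) sequentially"
      using d L2 u by (intro l2_tendsto_cut Y lim) auto
    moreover have "cut Y u \<in> L2 M" using cut_L2[OF Y L2[OF u]] .
    ultimately have "cut Y u \<in> ?D \<and> (\<lambda>n. form_val E (\<lambda>x. cut Y (W n) x - cut Y u x)) \<longlonglongrightarrow> 0"
      using closed[unfolded closed_form_def, rule_format, of "\<lambda>n. cut Y (W n)" "cut Y u"] d by blast
    then show ?thesis using W by blast
  qed
  have "form_bil E (cut Y u) (\<lambda>x. v x - cut Y v x) = 0" if u: "u \<in> ?D" and v: "v \<in> ?D" for u v
  proof -
    obtain W F where W: "\<And>n. form_operator M E (W n) (F n)"
      and lim: "(\<lambda>n. form_val E (\<lambda>x. cut Y (W n) x - cut Y u x)) \<longlonglongrightarrow> 0"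
      using approx[OF u] by blast
    have d: "cut Y (W n) \<in> ?D" for n
      using W[of n] inv by (auto simp: operator_invariant_def form_operator_def)
    have "(\<lambda>n. form_bil E (cut Y (W n)) (\<lambda>x. v x - cut Y v x)) \<longlonglongrightarrow>
        form_bil E (cut Y u) (\<lambda>x. v x - cut Y v x)"
      using approx[OF u] approx[OF v] v by (intro form_bil_tendsto[OF E d] dom lim) auto
    moreover have "form_bil E (cut Y (W n)) (\<lambda>x. v x - cut Y v x) = 0" for n
      using orth[OF W v] approx[OF v] by blast
    ultimately show ?thesis by (simp add: LIMSEQ_const_iff)
  qed
  then show ?thesis using approx by (simp add: form_invariant_def)
qed

text \<open>
  The splitting makes \<open>P\<close> symmetric for the form: \<open>E(P u, v) = E(P u, P v) = E(u, P v)\<close>. Hence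
  \<open>E(P u, v) = \<langle>L u, P v\<rangle> = \<langle>P L u, v\<rangle>\<close>.
\<close>

lemma form_invariant_imp_operator_invariant:
  assumes E: "nonneg_quadratic_form M E" and Y: "Y \<in> sets M" and inv: "form_invariant E Y"
  shows "operator_invariant M E Y"
  unfolding operator_invariant_def
proof (intro allI impI)
  fix u f assume op: "form_operator M E u f"
  let ?D = "form_dom E"
  note dom = form_dom_closed[OF E]
  have u: "u \<in> ?D" and f: "f \<in> L2 M" and uf: "\<And>v. v \<in> ?D \<Longrightarrow> form_bil E u v = l2_inner M f v"
    using op by (auto simp: form_operator_def)
  have cut: "v \<in> ?D \<Longrightarrow> cut Y v \<in> ?D" for v using inv by (simp add: form_invariant_def)
  have orth: "form_bil E (cut Y v) w = form_bil E (cut Y v) (cut Y w)"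
    if v: "v \<in> ?D" and w: "w \<in> ?D" for v w
  proof -
    have "form_bil E (cut Y v) (\<lambda>x. w x - cut Y w x) = 0"
      using inv v w by (simp add: form_invariant_def)
    then show ?thesis
      using form_bil_diff_right[OF E w cut[OF w] cut[OF v]] by simp
  qed
  have "form_bil E (cut Y u) v = l2_inner M (cut Y f) v" if v: "v \<in> ?D" for v
  proof -
    have "form_bil E (cut Y u) v = form_bil E (cut Y v) (cut Y u)"
      using orth[OF u v] form_bil_commute[OF E cut[OF u] cut[OF v]] by simp
    also have "\<dots> = form_bil E u (cut Y v)"
      using orth[OF v u] form_bil_commute[OF E u cut[OF v]] by simp
    also have "\<dots> = l2_inner M (cut Y f) v"
      using uf[OF cut[OF v]] by (simp add: l2_inner_cut)
    finally show ?thesis .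
  qed
  then show "form_operator M E (cut Y u) (cut Y f)"
    using cut[OF u] cut_L2[OF Y f] by (simp add: form_operator_def)
qed

section \<open>From the operator to the semigroup\<close>

text \<open>
  A function whose increments to the right are at most \<open>o(h)\<close> does not increase, provided that it
  cannot jump up at a point approached from the left. For each slope \<open>c > 0\<close> the bound
  \<open>f r \<le> f 0 + c r\<close> propagates from \<open>0\<close>: it holds up to a supremum \<open>\<sigma>\<close> by the condition on the left,
  and beyond \<open>\<sigma>\<close> by the one on the right unless \<open>\<sigma> = t\<close>.
\<close>

lemma right_increments_nonpos_imp_le:
  fixes f :: "real \<Rightarrow> real"
  assumes t: "0 < t"
    and right: "\<And>s e. 0 \<le> s \<Longrightarrow> s < t \<Longrightarrow> 0 < e \<Longrightarrow> \<forall>\<^sub>F h in at_right 0. f (s + h) \<le> f s + e * h"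
    and left: "\<And>s e. 0 < s \<Longrightarrow> s \<le> t \<Longrightarrow> 0 < e \<Longrightarrow> \<exists>r0<s. \<forall>r. r0 < r \<and> 0 \<le> r \<and> r < s \<longrightarrow> f s \<le> f r + e"
  shows "f t \<le> f 0"
proof -
  have bound: "f t \<le> f 0 + c * t" if c: "c > 0" for c
  proof -
    define S where "S = {s. 0 \<le> s \<and> s \<le> t \<and> (\<forall>r. 0 \<le> r \<and> r \<le> s \<longrightarrow> f r \<le> f 0 + c * r)}"
    define \<sigma> where "\<sigma> = Sup S"
    have S0: "0 \<in> S" using t by (auto simp: S_def intro: order_antisym)
    have bdd: "bdd_above S" by (auto simp: S_def intro!: bdd_aboveI[of _ t])
    have \<sigma>: "0 \<le> \<sigma>" "\<sigma> \<le> t"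
      using S0 bdd unfolding \<sigma>_def by (auto intro!: cSup_upper cSup_least simp: S_def)
    have below: "f r \<le> f 0 + c * r" if r: "0 \<le> r" "r < \<sigma>" for r
    proof -
      obtain s where "s \<in> S" "r < s"
        using r(2) S0 bdd less_cSup_iff[of S r] unfolding \<sigma>_def by auto
      then show ?thesis using r by (auto simp: S_def)
    qed
    have at: "f \<sigma> \<le> f 0 + c * \<sigma>"
    proof (cases "\<sigma> = 0")
      case False
      show ?thesis
      proof (rule field_le_epsilon)
        fix e :: real assume e: "e > 0"
        obtain r0 where r0: "r0 < \<sigma>" "\<And>r. r0 < r \<Longrightarrow> 0 \<le> r \<Longrightarrow> r < \<sigma> \<Longrightarrow> f \<sigma> \<le> f r + e"
          using left[of \<sigma> e] \<sigma> False e by auto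
        obtain r where r: "max 0 r0 < r" "r < \<sigma>"
          using dense[of "max 0 r0" \<sigma>] r0 \<sigma> False by auto
        have "f \<sigma> \<le> f r + e" using r0(2) r by auto
        also have "f r \<le> f 0 + c * r" using below r by auto
        also have "c * r \<le> c * \<sigma>" using c r by simp
        finally show "f \<sigma> \<le> f 0 + c * \<sigma> + e" by simp
      qed
    qed simp
    have "\<sigma> = t"
    proof (rule ccontr)
      assume "\<sigma> \<noteq> t"
      then have lt: "\<sigma> < t" using \<sigma> by simp
      obtain b where b: "b > 0" "\<And>h. 0 < h \<Longrightarrow> h < b \<Longrightarrow> f (\<sigma> + h) \<le> f \<sigma> + c * h"
        using right[OF \<sigma>(1) lt c] unfolding eventually_at_right_field by auto
      define s where "s = min t (\<sigma> + b / 2)"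
      have s: "\<sigma> < s" "s \<le> t" "s < \<sigma> + b" using lt b(1) by (auto simp: s_def)
      have "f r \<le> f 0 + c * r" if r: "0 \<le> r" "r \<le> s" for r
      proof (cases "r \<le> \<sigma>")
        case True
        then show ?thesis using below[OF r(1)] at by (cases "r = \<sigma>") auto
      next
        case False
        then have "f (\<sigma> + (r - \<sigma>)) \<le> f \<sigma> + c * (r - \<sigma>)"
          using r s by (intro b(2)) auto
        then show ?thesis using at by (simp add: algebra_simps)
      qed
      then have "s \<in> S" using s \<sigma> by (auto simp: S_def)
      then have "s \<le> \<sigma>" unfolding \<sigma>_def using bdd by (rule cSup_upper)
      then show False using s by simp
    qed
    then show ?thesis using at by simp
  qed
  show ?thesis
  proof (rule field_le_epsilon)
    fix e :: real assume "e > 0"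
    then show "f t \<le> f 0 + e" using bound[of "e / t"] t by simp
  qed
qed

lemma semigroup_generator_orbit:
  assumes sg: "contraction_semigroup M T" and gen: "semigroup_generator M T u f" and s: "s > 0"
  shows "semigroup_generator M T (T s u) (T s f)"
proof -
  have u: "u \<in> L2 M" and f: "f \<in> L2 M" and lim: "l2_tendsto M (\<lambda>t x. (T t u x - u x) / t) f (at_right 0)"
    using gen by (auto simp: semigroup_generator_def)
  let ?d = "\<lambda>t x. (T t (T s u) x - T s u x) / t - T s f x"
  let ?q = "\<lambda>t x. (1/t) * (T t u x - u x)"
  have le: "norm (l2_norm M (?d t)) \<le> l2_norm M (\<lambda>x. ?q t x - f x)" if t: "t > 0" for t
  proof -
    have L2: "T t u \<in> L2 M" "T s u \<in> L2 M" "T s f \<in> L2 M" "T t (T s u) \<in> L2 M" "T s (T t u) \<in> L2 M"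
      using t s u f by (auto intro!: semigroup_L2[OF sg])
    have diff: "(\<lambda>x. T t u x - u x) \<in> L2 M" by (rule L2_diff[OF L2(1) u])
    have q: "?q t \<in> L2 M" "T s (?q t) \<in> L2 M"
      using L2_scale[OF diff] semigroup_L2[OF sg s] by blast+
    have d: "?d t \<in> L2 M"
      using L2_diff[OF L2_scale[OF L2_diff[OF L2(4,2)], of "1/t"] L2(3)] by simp
    have "l2_norm M (?d t) = l2_norm M (\<lambda>x. T s (?q t) x - T s f x)"
    proof (rule l2_norm_cong_AE[OF d L2_diff[OF q(2) L2(3)]])
      show "AE x in M. ?d t x = T s (?q t) x - T s f x"
        using semigroup_scale[OF sg s diff, of "1/t"] semigroup_diff[OF sg s L2(1) u]
          semigroup_swap[OF sg t s u]
        by eventually_elim simp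
    qed
    then show ?thesis using semigroup_dist_le[OF sg s q(1) f] by simp
  qed
  have "l2_tendsto M (\<lambda>t x. (T t (T s u) x - T s u x) / t) (T s f) (at_right 0)"
    unfolding l2_tendsto_def
  proof (rule Lim_null_comparison)
    show "\<forall>\<^sub>F t in at_right 0. norm (l2_norm M (?d t)) \<le> l2_norm M (\<lambda>x. ?q t x - f x)"
      using le by (auto simp: eventually_at_right_field intro: exI[of _ 1])
    show "((\<lambda>t. l2_norm M (\<lambda>x. ?q t x - f x)) \<longlongrightarrow> 0) (at_right 0)"
      using lim by (simp add: l2_tendsto_def)
  qed
  then show ?thesis
    using semigroup_L2[OF sg s u] semigroup_L2[OF sg s f] by (simp add: semigroup_generator_def)
qed

definition commutator :: "'a set \<Rightarrow> (('a \<Rightarrow> real) \<Rightarrow> 'a \<Rightarrow> real) \<Rightarrow> ('a \<Rightarrow> real) \<Rightarrow> 'a \<Rightarrow> real" where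
  "commutator Y S u = (\<lambda>x. cut Y (S u) x - S (cut Y u) x)"

text \<open>
  \<open>[P, T\<^sub>h] u = P (T\<^sub>h u - u) - (T\<^sub>h P u - P u)\<close>; both differences, divided by \<open>h\<close>, tend to \<open>P f\<close>.
\<close>

lemma commutator_small:
  assumes sg: "contraction_semigroup M T" and Y: "Y \<in> sets M"
    and gen: "semigroup_generator M T u f" "semigroup_generator M T (cut Y u) (cut Y f)" and e: "e > 0"
  shows "\<forall>\<^sub>F h in at_right 0. l2_norm M (commutator Y (T h) u) \<le> e * h"
proof -
  let ?q = "\<lambda>u h x. (T h u x - u x) / h"
  let ?g = "\<lambda>h. l2_norm M (\<lambda>x. ?q u h x - f x) + l2_norm M (\<lambda>x. ?q (cut Y u) h x - cut Y f x)"
  have u: "u \<in> L2 M" "cut Y u \<in> L2 M" and f: "f \<in> L2 M" "cut Y f \<in> L2 M"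
    using gen by (auto simp: semigroup_generator_def)
  have "(?g \<longlongrightarrow> 0 + 0) (at_right 0)"
    using gen unfolding semigroup_generator_def l2_tendsto_def by (intro tendsto_add) auto
  then have "\<forall>\<^sub>F h in at_right 0. ?g h < e" using e by (intro order_tendstoD(2)) auto
  moreover have "\<forall>\<^sub>F h in at_right 0. (0::real) < h" by (simp add: eventually_at_right_less)
  ultimately show ?thesis
  proof eventually_elim
    case (elim h)
    have L2: "T h u \<in> L2 M" "T h (cut Y u) \<in> L2 M"
      using elim u by (auto intro!: semigroup_L2[OF sg])
    have qu: "(\<lambda>x. ?q u h x - f x) \<in> L2 M"
      using L2_diff[OF L2_scale[OF L2_diff[OF L2(1) u(1)], of "1/h"] f(1)] by simp
    have qc: "(\<lambda>x. ?q (cut Y u) h x - cut Y f x) \<in> L2 M"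
      using L2_diff[OF L2_scale[OF L2_diff[OF L2(2) u(2)], of "1/h"] f(2)] by simp
    have "commutator Y (T h) u =
        (\<lambda>x. h * (cut Y (\<lambda>x. ?q u h x - f x) x - (?q (cut Y u) h x - cut Y f x)))"
      using elim by (simp add: commutator_def fun_eq_iff cut_apply field_simps)
    then have "l2_norm M (commutator Y (T h) u) =
        h * l2_norm M (\<lambda>x. cut Y (\<lambda>x. ?q u h x - f x) x - (?q (cut Y u) h x - cut Y f x))"
      using elim by (simp only: l2_norm_scale abs_of_pos)
    also have "\<dots> \<le> h * ?g h"
      using elim l2_norm_diff_le[OF cut_L2[OF Y qu] qc] l2_norm_cut_le[OF Y qu]
      by (intro mult_left_mono) auto
    also have "\<dots> \<le> h * e" using elim by (intro mult_left_mono) auto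
    finally show ?case by (simp add: mult.commute)
  qed
qed

lemma commutator_L2:
  "contraction_semigroup M T \<Longrightarrow> Y \<in> sets M \<Longrightarrow> s > 0 \<Longrightarrow> u \<in> L2 M \<Longrightarrow> commutator Y (T s) u \<in> L2 M"
  unfolding commutator_def by (rule L2_diff[OF cut_L2[OF _ semigroup_L2] semigroup_L2[OF _ _ cut_L2]])

text \<open>
  \<open>[P, T\<^sub>s\<^sub>+\<^sub>h] = [P, T\<^sub>h] T\<^sub>s + T\<^sub>h [P, T\<^sub>s]\<close>, and \<open>T\<^sub>h\<close> is a contraction. This bounds the growth of the
  commutator over a step \<open>h\<close> by the commutator of \<open>T\<^sub>h\<close> alone.
\<close>

lemma commutator_add:
  assumes sg: "contraction_semigroup M T" and Y: "Y \<in> sets M" and s: "s > 0" and h: "h > 0"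
    and u: "u \<in> L2 M"
  shows "l2_norm M (commutator Y (T (s + h)) u) \<le>
    l2_norm M (commutator Y (T s) u) + l2_norm M (commutator Y (T h) (T s u))"
proof -
  let ?w = "T s u" and ?C = "commutator Y (T s) u"
  have L2: "?w \<in> L2 M" "cut Y ?w \<in> L2 M" "T s (cut Y u) \<in> L2 M" "cut Y u \<in> L2 M" "?C \<in> L2 M"
      "T h ?C \<in> L2 M" "commutator Y (T h) ?w \<in> L2 M" "commutator Y (T (s + h)) u \<in> L2 M"
    using u s h Y by (auto intro!: semigroup_L2[OF sg] cut_L2 commutator_L2[OF sg])
  have "AE x in M. commutator Y (T (s + h)) u x = T h ?C x + commutator Y (T h) ?w x"
    using semigroup_diff[OF sg h L2(2,3)] semigroup_add[OF sg h s u] semigroup_add[OF sg h s L2(4)]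
    by eventually_elim (simp add: commutator_def cut_apply add.commute)
  then have "l2_norm M (commutator Y (T (s + h)) u) = l2_norm M (\<lambda>x. T h ?C x + commutator Y (T h) ?w x)"
    using L2 by (intro l2_norm_cong_AE L2_add)
  also have "\<dots> \<le> l2_norm M (T h ?C) + l2_norm M (commutator Y (T h) ?w)"
    using L2 by (intro l2_norm_triangle)
  also have "l2_norm M (T h ?C) \<le> l2_norm M ?C"
    by (rule semigroup_contraction[OF sg h L2(5)])
  finally show ?thesis by simp
qed

text \<open>
  The correction term depends on \<open>h\<close> only, so the estimate is uniform as \<open>r\<close> approaches \<open>r + h\<close> from
  below.
\<close>

lemma commutator_continuous_left:
  assumes sg: "contraction_semigroup M T" and Y: "Y \<in> sets M" and r: "r > 0" and h: "h > 0"
    and u: "u \<in> L2 M"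
  shows "l2_norm M (commutator Y (T (r + h)) u) \<le> l2_norm M (commutator Y (T r) u)
    + (l2_norm M (\<lambda>x. T h u x - u x) + l2_norm M (\<lambda>x. T h (cut Y u) x - cut Y u x))"
proof -
  have c: "cut Y u \<in> L2 M" by (rule cut_L2[OF Y u])
  have L2: "T r u \<in> L2 M" "T (r + h) u \<in> L2 M" "T r (cut Y u) \<in> L2 M" "T (r + h) (cut Y u) \<in> L2 M"
    using u c r h by (auto intro!: semigroup_L2[OF sg])
  let ?D = "\<lambda>u x. T (r + h) u x - T r u x"
  have D: "?D u \<in> L2 M" "?D (cut Y u) \<in> L2 M" using L2 by (auto intro!: L2_diff)
  have CD: "(\<lambda>x. cut Y (?D u) x - ?D (cut Y u) x) \<in> L2 M" by (rule L2_diff[OF cut_L2[OF Y D(1)] D(2)])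
  have "commutator Y (T (r + h)) u = (\<lambda>x. commutator Y (T r) u x + (cut Y (?D u) x - ?D (cut Y u) x))"
    by (simp add: commutator_def cut_diff fun_eq_iff)
  then have "l2_norm M (commutator Y (T (r + h)) u)
      \<le> l2_norm M (commutator Y (T r) u) + l2_norm M (\<lambda>x. cut Y (?D u) x - ?D (cut Y u) x)"
    using l2_norm_triangle[OF commutator_L2[OF sg Y r u] CD] by simp
  also have "l2_norm M (\<lambda>x. cut Y (?D u) x - ?D (cut Y u) x)
      \<le> l2_norm M (cut Y (?D u)) + l2_norm M (?D (cut Y u))"
    by (rule l2_norm_diff_le[OF cut_L2[OF Y D(1)] D(2)])
  also have "\<dots> \<le> l2_norm M (?D u) + l2_norm M (?D (cut Y u))"
    using l2_norm_cut_le[OF Y D(1)] by simp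
  also have "\<dots> \<le> l2_norm M (\<lambda>x. T h u x - u x) + l2_norm M (\<lambda>x. T h (cut Y u) x - cut Y u x)"
    by (intro add_mono semigroup_time_dist_le[OF sg r h] u c)
  finally show ?thesis by simp
qed

text \<open>
  The orbit \<open>T\<^sub>s u\<close> stays in the domain of \<open>L\<close>, and there \<open>P\<close> commutes with the generator. So the
  commutator of \<open>T\<^sub>h\<close> on \<open>T\<^sub>s u\<close> is \<open>o(h)\<close>, and the norm of \<open>[P, T\<^sub>s] u\<close> cannot grow away from \<open>0\<close>.
\<close>

lemma operator_invariant_imp_commutator_zero:
  assumes sg: "form_semigroup M E T" and Y: "Y \<in> sets M" and inv: "operator_invariant M E Y"
    and op: "form_operator M E u g" and t: "t > 0"
  shows "l2_norm M (commutator Y (T t) u) = 0"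
proof -
  have T: "contraction_semigroup M T"
    and gen_op: "\<And>u f. semigroup_generator M T u f \<longleftrightarrow> form_operator M E u (\<lambda>x. - f x)"
    using sg by (auto simp: form_semigroup_def)
  have gen_cut: "semigroup_generator M T (cut Y u) (cut Y f)" if "semigroup_generator M T u f" for u f
  proof -
    have "form_operator M E (cut Y u) (cut Y (\<lambda>x. - f x))"
      using inv that by (simp add: operator_invariant_def gen_op)
    moreover have "cut Y (\<lambda>x. - f x) = (\<lambda>x. - cut Y f x)" by (simp add: cut_def)
    ultimately show ?thesis by (simp add: gen_op)
  qed
  have gen: "semigroup_generator M T u (\<lambda>x. - g x)" using op by (simp add: gen_op)
  then have u: "u \<in> L2 M" by (simp add: semigroup_generator_def)
  have c: "cut Y u \<in> L2 M" by (rule cut_L2[OF Y u])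
  \<comment> \<open>\<open>T 0\<close> is arbitrary; the value that fits the continuous extension is prescribed instead\<close>
  define f where "f s = (if s = 0 then 0 else l2_norm M (commutator Y (T s) u))" for s
  have f_pos: "s > 0 \<Longrightarrow> f s = l2_norm M (commutator Y (T s) u)" for s by (simp add: f_def)
  have pos: "\<forall>\<^sub>F h in at_right 0. (0::real) < h" by (simp add: eventually_at_right_less)
  have "f t \<le> f 0"
  proof (rule right_increments_nonpos_imp_le[OF t])
    fix s e :: real assume s: "0 \<le> s" and e: "0 < e"
    show "\<forall>\<^sub>F h in at_right 0. f (s + h) \<le> f s + e * h"
    proof (cases "s = 0")
      case True
      then show ?thesis
        using commutator_small[OF T Y gen gen_cut[OF gen] e] pos
        by (auto simp: f_def elim: eventually_elim2)
    next
      case False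
      then have s: "s > 0" using s by simp
      note gs = semigroup_generator_orbit[OF T gen s]
      show ?thesis
        using commutator_small[OF T Y gs gen_cut[OF gs] e] pos
      proof eventually_elim
        case (elim h)
        then show ?case using commutator_add[OF T Y s _ u, of h] s by (simp add: f_pos)
      qed
    qed
  next
    fix s e :: real assume s: "0 < s" and e: "0 < e"
    let ?g = "\<lambda>h. l2_norm M (\<lambda>x. T h u x - u x) + l2_norm M (\<lambda>x. T h (cut Y u) x - cut Y u x)"
    have "(?g \<longlongrightarrow> 0 + 0) (at_right 0)"
      using semigroup_strong_continuity[OF T u] semigroup_strong_continuity[OF T c]
      unfolding l2_tendsto_def by (intro tendsto_add)
    then have "\<forall>\<^sub>F h in at_right 0. ?g h < e" using e by (intro order_tendstoD(2)) auto
    then obtain b where b: "b > 0" "\<And>h. 0 < h \<Longrightarrow> h < b \<Longrightarrow> ?g h < e"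
      unfolding eventually_at_right_field by auto
    have "f s \<le> f r + e" if r: "max 0 (s - b) < r" "r < s" for r
    proof -
      have "l2_norm M (commutator Y (T (r + (s - r))) u) \<le> l2_norm M (commutator Y (T r) u) + ?g (s - r)"
        using r by (intro commutator_continuous_left[OF T Y _ _ u]) auto
      also have "?g (s - r) < e" using r by (intro b(2)) auto
      finally show ?thesis using r by (simp add: f_pos)
    qed
    then show "\<exists>r0<s. \<forall>r. r0 < r \<and> 0 \<le> r \<and> r < s \<longrightarrow> f s \<le> f r + e"
      using s b by (intro exI[of _ "max 0 (s - b)"]) auto
  qed
  then have "l2_norm M (commutator Y (T t) u) \<le> 0" using t by (simp add: f_def)
  then show ?thesis using l2_norm_nonneg[of M "commutator Y (T t) u"] by linarith
qed

text \<open>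
  The commutator of \<open>T\<^sub>t\<close> vanishes on the dense domain of \<open>L\<close> and is bounded by \<open>2\<close> in operator norm.
\<close>

lemma operator_invariant_imp_semigroup_invariant:
  assumes E: "nonneg_quadratic_form M E" and closed: "closed_form M E" and dense: "densely_defined M E"
    and sg: "form_semigroup M E T" and Y: "Y \<in> sets M" and inv: "operator_invariant M E Y" and t: "t > 0"
  shows "invariant_set M (T t) Y"
  unfolding invariant_set_iff_cut
proof (intro conjI ballI)
  show "Y \<in> sets M" by (rule Y)
  fix u assume u: "u \<in> L2 M"
  have T: "contraction_semigroup M T" using sg by (simp add: form_semigroup_def)
  have small: "l2_norm M (commutator Y (T t) u) \<le> e" if e: "e > 0" for e
  proof -
    obtain w f where w: "form_operator M E w f" and uw: "l2_norm M (\<lambda>x. u x - w x) < e / 2"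
      using form_operator_domain_dense[OF E closed dense u, of "e/2"] e by auto
    have w_L2: "w \<in> L2 M" using w form_dom_L2[OF E] by (auto simp: form_operator_def)
    let ?d = "\<lambda>x. u x - w x"
    have d: "?d \<in> L2 M" by (rule L2_diff[OF u w_L2])
    have L2: "T t u \<in> L2 M" "T t w \<in> L2 M" "cut Y u \<in> L2 M" "cut Y w \<in> L2 M"
        "T t ?d \<in> L2 M" "T t (cut Y ?d) \<in> L2 M" "cut Y ?d \<in> L2 M"
        "cut Y (T t ?d) \<in> L2 M"
      using u w_L2 t Y d by (auto intro!: semigroup_L2[OF T] cut_L2)
    note C_L2 = commutator_L2[OF T Y t]
    have "AE x in M. T t (cut Y ?d) x = T t (cut Y u) x - T t (cut Y w) x"
      unfolding cut_diff by (rule semigroup_diff[OF T t L2(3,4)])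
    with semigroup_diff[OF T t u w_L2]
    have "AE x in M. commutator Y (T t) u x = commutator Y (T t) w x + commutator Y (T t) ?d x"
    proof eventually_elim
      case (elim x)
      show ?case unfolding commutator_def cut_apply elim by (simp add: algebra_simps)
    qed
    then have "l2_norm M (commutator Y (T t) u) = l2_norm M (\<lambda>x. commutator Y (T t) w x + commutator Y (T t) ?d x)"
      by (intro l2_norm_cong_AE C_L2 L2_add u w_L2 d)
    also have "\<dots> \<le> l2_norm M (commutator Y (T t) w) + l2_norm M (commutator Y (T t) ?d)"
      by (intro l2_norm_triangle C_L2 w_L2 d)
    also have "l2_norm M (commutator Y (T t) w) = 0"
      by (rule operator_invariant_imp_commutator_zero[OF sg Y inv w t])
    also have "l2_norm M (commutator Y (T t) ?d) \<le> l2_norm M (cut Y (T t ?d)) + l2_norm M (T t (cut Y ?d))"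
      unfolding commutator_def by (rule l2_norm_diff_le[OF L2(8,6)])
    also have "\<dots> \<le> l2_norm M ?d + l2_norm M ?d"
      using l2_norm_cut_le[OF Y L2(5)] semigroup_contraction[OF T t d]
        semigroup_contraction[OF T t L2(7)] l2_norm_cut_le[OF Y d] by linarith
    finally show ?thesis using uw by simp
  qed
  have "l2_norm M (commutator Y (T t) u) \<le> 0"
    by (rule field_le_epsilon) (use small in simp)
  then have "l2_norm M (commutator Y (T t) u) = 0"
    using l2_norm_nonneg[of M "commutator Y (T t) u"] by linarith
  then have "AE x in M. commutator Y (T t) u x = 0"
    using l2_norm_eq_0_iff[OF commutator_L2[OF T Y t u]] by simp
  then show "AE x in M. T t (cut Y u) x = cut Y (T t u) x"
    by eventually_elim (simp add: commutator_def)
qed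

section \<open>Passage to the Mosco limit\<close>

lemma form_invariant_split:
  assumes E: "nonneg_quadratic_form M E" and inv: "form_invariant E Y" and u: "u \<in> form_dom E"
  shows "form_val E u = form_val E (cut Y u) + form_val E (\<lambda>x. u x - cut Y u x)"
proof -
  have c: "cut Y u \<in> form_dom E" using inv u by (simp add: form_invariant_def)
  have "form_val E (\<lambda>x. cut Y u x + (u x - cut Y u x)) = form_val E (cut Y u)
      + 2 * form_bil E (cut Y u) (\<lambda>x. u x - cut Y u x) + form_val E (\<lambda>x. u x - cut Y u x)"
    by (rule form_val_add[OF E c form_dom_diff[OF E u c]])
  then show ?thesis using inv u by (simp add: form_invariant_def)
qed

lemma form_ext_nonneg: "nonneg_quadratic_form M E \<Longrightarrow> 0 \<le> form_ext E u"
  by (auto simp: form_ext_def dest: form_val_nonneg)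

lemma form_ext_split_le:
  assumes E: "nonneg_quadratic_form M E" and inv: "form_invariant E Y"
  shows "form_ext E (cut Y u) + form_ext E (\<lambda>x. u x - cut Y u x) \<le> form_ext E u"
proof (cases "u \<in> form_dom E")
  case True
  then have "cut Y u \<in> form_dom E" using inv by (simp add: form_invariant_def)
  then show ?thesis
    using True form_invariant_split[OF E inv True] form_dom_diff[OF E True]
    by (simp add: form_ext_def)
qed (simp add: form_ext_def)

lemma form_ext_cut_le:
  assumes E: "nonneg_quadratic_form M E" and inv: "form_invariant E Y"
  shows "form_ext E (cut Y u) \<le> form_ext E u"
  using form_ext_split_le[OF E inv, of u] form_ext_nonneg[OF E, of "\<lambda>x. u x - cut Y u x"]
  by (metis add.right_neutral add_left_mono order_trans)

text \<open>
  The inequality says that \<open>E(P z, z - P z) \<ge> 0\<close>. The vectors \<open>P u\<close> and \<open>s (v - P v)\<close> are the two parts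
  of their sum \<open>z\<close>, whence \<open>s E(P u, v - P v) \<ge> 0\<close> for both signs of \<open>s\<close>.
\<close>

lemma form_invariantI:
  assumes E: "nonneg_quadratic_form M E"
    and cut: "\<And>u. u \<in> form_dom E \<Longrightarrow> cut Y u \<in> form_dom E"
    and split: "\<And>u. u \<in> form_dom E \<Longrightarrow>
      form_val E (cut Y u) + form_val E (\<lambda>x. u x - cut Y u x) \<le> form_val E u"
  shows "form_invariant E Y"
proof -
  note dom = form_dom_closed[OF E]
  have "form_bil E (cut Y u) (\<lambda>x. v x - cut Y v x) = 0"
    if u: "u \<in> form_dom E" and v: "v \<in> form_dom E" for u v
  proof -
    let ?p = "cut Y u" and ?q = "\<lambda>x. v x - cut Y v x"
    have p: "?p \<in> form_dom E" and q: "?q \<in> form_dom E" using u v cut by (auto intro!: dom)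
    have ge: "0 \<le> s * form_bil E ?p ?q" for s
    proof -
      let ?z = "\<lambda>x. ?p x + s * ?q x"
      have z: "?z \<in> form_dom E" by (rule form_dom_add[OF E p form_dom_scale[OF E q]])
      have zp: "cut Y ?z = ?p" by (simp add: cut_def fun_eq_iff indicator_def)
      have zq: "(\<lambda>x. ?z x - ?p x) = (\<lambda>x. s * ?q x)" by simp
      have sq: "(\<lambda>x. s * ?q x) \<in> form_dom E" using q by (rule form_dom_scale[OF E])
      have "form_val E ?z = form_val E ?p + 2 * form_bil E ?p (\<lambda>x. s * ?q x) + form_val E (\<lambda>x. s * ?q x)"
        by (rule form_val_add[OF E p sq])
      then show ?thesis
        using split[OF z] unfolding zp zq form_bil_scale_right[OF E q p] by simp
    qed
    show ?thesis using ge[of 1] ge[of "-1"] by simp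
  qed
  then show ?thesis using cut by (simp add: form_invariant_def)
qed

lemma mosco_lower_bound:
  assumes "mosco_converges M E Einf" "\<And>n. U n \<in> L2 M" "u \<in> L2 M"
    "l2_weak_tendsto M U u sequentially"
  shows "form_ext Einf u \<le> liminf (\<lambda>n. form_ext (E n) (U n))"
  using assms(1)[unfolded mosco_converges_def, THEN conjunct1, rule_format, of U u] assms(2-4)
  by simp

lemma mosco_recovery_sequence:
  assumes "mosco_converges M E Einf" "u \<in> L2 M"
  obtains U where "\<And>n. U n \<in> L2 M" "l2_tendsto M U u sequentially"
    "limsup (\<lambda>n. form_ext (E n) (U n)) \<le> form_ext Einf u"
  using assms(1)[unfolded mosco_converges_def, THEN conjunct2, rule_format, OF assms(2)] by blast

text \<open>
  Both parts of a recovery sequence for \<open>u\<close> converge to the corresponding parts of \<open>u\<close>; the lower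
  bounds for the parts add up to at most the upper bound for the whole.
\<close>

lemma form_invariant_mosco_limit:
  assumes E: "\<And>n. nonneg_quadratic_form M (E n)" and Einf: "nonneg_quadratic_form M Einf"
    and mosco: "mosco_converges M E Einf" and Y: "Y \<in> sets M" and inv: "\<And>n. form_invariant (E n) Y"
  shows "form_invariant Einf Y"
proof -
  have key: "form_ext Einf (cut Y u) + form_ext Einf (\<lambda>x. u x - cut Y u x) \<le> form_ext Einf u"
    if u: "u \<in> L2 M" for u
  proof -
    obtain U where U: "\<And>n. U n \<in> L2 M" and lim: "l2_tendsto M U u sequentially"
      and sup: "limsup (\<lambda>n. form_ext (E n) (U n)) \<le> form_ext Einf u"
      using mosco_recovery_sequence[OF mosco u] by blast
    let ?P = "\<lambda>n. cut Y (U n)" and ?Q = "\<lambda>n x. U n x - cut Y (U n) x"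
    have P: "?P n \<in> L2 M" and Q: "?Q n \<in> L2 M" for n
      using U Y by (auto intro!: L2_diff cut_L2)
    have Pu: "cut Y u \<in> L2 M" and Qu: "(\<lambda>x. u x - cut Y u x) \<in> L2 M"
      using u Y by (auto intro!: L2_diff cut_L2)
    have weak: "l2_weak_tendsto M U u sequentially" by (rule l2_tendsto_imp_weak[OF U u lim])
    have weakP: "l2_weak_tendsto M ?P (cut Y u) sequentially"
      using weak cut_L2[OF Y] by (simp add: l2_weak_tendsto_def l2_inner_cut)
    have weakQ: "l2_weak_tendsto M ?Q (\<lambda>x. u x - cut Y u x) sequentially"
      unfolding l2_weak_tendsto_def
    proof
      fix v assume v: "v \<in> L2 M"
      have "((\<lambda>n. l2_inner M (U n) v - l2_inner M (?P n) v) \<longlongrightarrow> l2_inner M u v - l2_inner M (cut Y u) v)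
          sequentially"
        using weak weakP v by (intro tendsto_diff) (auto simp: l2_weak_tendsto_def)
      then show "((\<lambda>n. l2_inner M (?Q n) v) \<longlongrightarrow> l2_inner M (\<lambda>x. u x - cut Y u x) v) sequentially"
        by (simp only: l2_inner_bilinear(1)[OF U P v] l2_inner_bilinear(1)[OF u Pu v])
    qed
    have M1: "form_ext Einf (cut Y u) \<le> liminf (\<lambda>n. form_ext (E n) (?P n))"
        "form_ext Einf (\<lambda>x. u x - cut Y u x) \<le> liminf (\<lambda>n. form_ext (E n) (?Q n))"
      by (rule mosco_lower_bound[OF mosco P Pu weakP], rule mosco_lower_bound[OF mosco Q Qu weakQ])
    have nn: "0 \<le> liminf (\<lambda>n. form_ext (E n) (V n))" for V
      by (intro Liminf_bounded always_eventually allI form_ext_nonneg[OF E])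
    have "form_ext Einf (cut Y u) + form_ext Einf (\<lambda>x. u x - cut Y u x)
        \<le> liminf (\<lambda>n. form_ext (E n) (?P n)) + liminf (\<lambda>n. form_ext (E n) (?Q n))"
      by (intro add_mono M1)
    also have "\<dots> \<le> liminf (\<lambda>n. form_ext (E n) (?P n) + form_ext (E n) (?Q n))"
      using nn[of ?P] nn[of ?Q] by (intro ereal_liminf_add_mono) auto
    also have "\<dots> \<le> liminf (\<lambda>n. form_ext (E n) (U n))"
      by (intro Liminf_mono always_eventually allI form_ext_split_le[OF E inv])
    also have "\<dots> \<le> limsup (\<lambda>n. form_ext (E n) (U n))"
      by (intro Liminf_le_Limsup) simp
    finally show ?thesis using sup by simp
  qed
  have fin: "cut Y u \<in> form_dom Einf \<and>
      form_val Einf (cut Y u) + form_val Einf (\<lambda>x. u x - cut Y u x) \<le> form_val Einf u"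
    if u: "u \<in> form_dom Einf" for u
  proof -
    have c: "cut Y u \<in> form_dom Einf"
    proof (rule ccontr)
      assume "cut Y u \<notin> form_dom Einf"
      then show False
        using key[OF form_dom_L2[OF Einf u]] u form_ext_nonneg[OF Einf, of "\<lambda>x. u x - cut Y u x"]
        by (simp add: form_ext_def)
    qed
    then show ?thesis
      using key[OF form_dom_L2[OF Einf u]] u form_dom_diff[OF Einf u c] by (simp add: form_ext_def)
  qed
  show ?thesis by (rule form_invariantI[OF Einf]) (use fin in blast)+
qed

section \<open>Restriction to an invariant set\<close>

lemma L2_restrict_space_iff:
  assumes Y: "Y \<in> sets M"
  shows "f \<in> L2 (restrict_space M Y) \<longleftrightarrow> cut Y f \<in> L2 M"
proof -
  have Y': "Y \<inter> space M \<in> sets M" using Y by simp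
  have "(\<lambda>x. indicator Y x * (f x)\<^sup>2) = (\<lambda>x. (cut Y f x)\<^sup>2)"
    by (simp add: fun_eq_iff cut_def indicator_def)
  then show ?thesis
    unfolding L2_def
    by (simp add: integrable_restrict_space[OF Y'] borel_measurable_restrict_space_iff[OF Y'] cut_def)
qed

lemma l2_inner_restrict_space:
  assumes Y: "Y \<in> sets M"
  shows "l2_inner (restrict_space M Y) f g = l2_inner M (cut Y f) g"
proof -
  have Y': "Y \<inter> space M \<in> sets M" using Y by simp
  show ?thesis
    by (simp add: l2_inner_def integral_restrict_space[OF Y'] cut_def mult.assoc)
qed

lemma l2_norm_restrict_space:
  assumes Y: "Y \<in> sets M"
  shows "l2_norm (restrict_space M Y) f = l2_norm M (cut Y f)"
  using l2_inner_cut[of M Y "cut Y f" f] by (simp add: l2_norm_def l2_inner_restrict_space[OF Y])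

text \<open>
  Restricted forms are evaluated by extension by zero. An arbitrary extension in the domain can be
  replaced by the one that vanishes outside \<open>Y\<close> because \<open>P\<close> preserves the domain.
\<close>

lemma form_ext_restrict:
  assumes inv: "form_invariant E Y"
  shows "form_ext (form_restrict Y E) f = form_ext E (cut Y f)"
proof -
  have "f \<in> form_dom (form_restrict Y E) \<longleftrightarrow> cut Y f \<in> form_dom E"
  proof
    assume "f \<in> form_dom (form_restrict Y E)"
    then obtain u where u: "u \<in> form_dom E" "\<forall>x\<in>Y. f x = u x"
      by (auto simp: form_restrict_def)
    then have "cut Y f = cut Y u" by (auto simp: cut_def fun_eq_iff indicator_def)
    then show "cut Y f \<in> form_dom E" using u inv by (simp add: form_invariant_def)
  next
    assume "cut Y f \<in> form_dom E"
    then show "f \<in> form_dom (form_restrict Y E)"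
      by (auto simp: form_restrict_def cut_def intro!: bexI[of _ "cut Y f"])
  qed
  then show ?thesis by (simp add: form_ext_def form_val_def form_restrict_def cut_def)
qed

text \<open>
  Extension by zero is an isometry onto the range of \<open>P\<close> and preserves weak convergence, which gives
  (M1). For (M2), multiplying a recovery sequence by the indicator does not raise the values
  of the approximating forms.
\<close>

lemma mosco_converges_restrict:
  assumes E: "\<And>n. nonneg_quadratic_form M (E n)"
    and mosco: "mosco_converges M E Einf" and Y: "Y \<in> sets M" and inv: "\<And>n. form_invariant (E n) Y"
    and inv_inf: "form_invariant Einf Y"
  shows "mosco_converges (restrict_space M Y) (\<lambda>n. form_restrict Y (E n)) (form_restrict Y Einf)"
  unfolding mosco_converges_def form_ext_restrict[OF inv] form_ext_restrict[OF inv_inf]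
    L2_restrict_space_iff[OF Y]
proof (intro conjI allI ballI impI)
  fix U u
  assume *: "(\<forall>n. cut Y (U n) \<in> L2 M) \<and> cut Y u \<in> L2 M
      \<and> l2_weak_tendsto (restrict_space M Y) U u sequentially"
  have "l2_weak_tendsto M (\<lambda>n. cut Y (U n)) (cut Y u) sequentially"
    using * cut_L2[OF Y]
    by (simp add: l2_weak_tendsto_def l2_inner_restrict_space[OF Y] L2_restrict_space_iff[OF Y])
  then show "form_ext Einf (cut Y u) \<le> liminf (\<lambda>n. form_ext (E n) (cut Y (U n)))"
    using mosco * by (intro mosco_lower_bound[OF mosco]) auto
next
  fix u assume "u \<in> L2 (restrict_space M Y)"
  then have u: "cut Y u \<in> L2 M" by (simp add: L2_restrict_space_iff[OF Y])
  obtain U where U: "\<And>n. U n \<in> L2 M" and lim: "l2_tendsto M U (cut Y u) sequentially"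
    and sup: "limsup (\<lambda>n. form_ext (E n) (U n)) \<le> form_ext Einf (cut Y u)"
    using mosco_recovery_sequence[OF mosco u] by blast
  have "l2_tendsto (restrict_space M Y) U u sequentially"
    using l2_tendsto_cut[OF Y U u lim]
    by (simp add: l2_tendsto_def l2_norm_restrict_space[OF Y] cut_diff)
  moreover have "limsup (\<lambda>n. form_ext (E n) (cut Y (U n))) \<le> limsup (\<lambda>n. form_ext (E n) (U n))"
    by (intro Limsup_mono always_eventually allI form_ext_cut_le[OF E inv])
  ultimately show "\<exists>U. (\<forall>n. cut Y (U n) \<in> L2 M) \<and> l2_tendsto (restrict_space M Y) U u sequentially \<and>
      limsup (\<lambda>n. form_ext (E n) (cut Y (U n))) \<le> form_ext Einf (cut Y u)"
    using cut_L2[OF Y U] sup order_trans by blast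
qed

section \<open>Invariant sets under Mosco convergence\<close>

theorem theorem3p5:
  fixes X :: "'a topology"
    and M :: "'a measure"
    and E :: "nat \<Rightarrow> 'a qform"
    and Einf :: "'a qform"
    and T :: "nat \<Rightarrow> real \<Rightarrow> ('a \<Rightarrow> real) \<Rightarrow> 'a \<Rightarrow> real"
    and Tinf :: "real \<Rightarrow> ('a \<Rightarrow> real) \<Rightarrow> 'a \<Rightarrow> real"
    and Y :: "'a set"
  assumes "Hausdorff_space X"
    and "radon_measure X M"
    and "sigma_finite_measure M"
    and "full_support X M"
    and "\<And>k. dirichlet_form M (E k)"
    and "\<And>k. form_semigroup M (E k) (T k)"
    and "dirichlet_form M Einf"
    and "form_semigroup M Einf Tinf"
    and "mosco_converges M E Einf"
    and "\<And>k. \<exists>t>0. invariant_set M (T k t) Y"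
  shows "(\<forall>t>0. invariant_set M (Tinf t) Y) \<and>
    mosco_converges (restrict_space M Y) (\<lambda>k. form_restrict Y (E k)) (form_restrict Y Einf)"
proof -
  have E: "nonneg_quadratic_form M (E k)" "closed_form M (E k)" for k
    using assms(5) by (auto simp: dirichlet_form_def)
  have Einf: "nonneg_quadratic_form M Einf" "closed_form M Einf" "densely_defined M Einf"
    using assms(7) by (auto simp: dirichlet_form_def)
  have Y: "Y \<in> sets M" using assms(10) by (auto simp: invariant_set_def)
  have inv: "form_invariant (E k) Y" for k
  proof -
    obtain t where t: "t > 0" "invariant_set M (T k t) Y" using assms(10) by blast
    have "contraction_semigroup M (T k)" using assms(6) by (simp add: form_semigroup_def)
    from invariant_set_all_times[OF this t] have "invariant_set M (T k s) Y" if "s > 0" for s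
      using that by blast
    then have "operator_invariant M (E k) Y"
      by (rule semigroup_invariant_imp_operator_invariant[OF assms(6)])
    then show ?thesis by (rule operator_invariant_imp_form_invariant[OF E Y])
  qed
  have inv_inf: "form_invariant Einf Y"
    by (rule form_invariant_mosco_limit[OF E(1) Einf(1) assms(9) Y inv])
  have "invariant_set M (Tinf t) Y" if "t > 0" for t
    using operator_invariant_imp_semigroup_invariant[OF Einf assms(8) Y _ that]
      form_invariant_imp_operator_invariant[OF Einf(1) Y inv_inf] by blast
  moreover have "mosco_converges (restrict_space M Y) (\<lambda>k. form_restrict Y (E k)) (form_restrict Y Einf)"
    by (rule mosco_converges_restrict[OF E(1) assms(9) Y inv inv_inf])
  ultimately show ?thesis by blast
qed

end
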